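(* Let $n\ge2$ and let $\underline S=(S_1,\dots,S_n)$ be a pure Agler-Young contraction on a Hilbert space $\mathcal H$. Suppose $S_n$ is not an isometry and $\dim\mathcal D_{S_n^*}<\infty$. Then there are $n-1$ bounded operators $Y_1,\dots,Y_{n-1}$ on $\mathcal D_{S_n^*}$ such that $\underline S$ is unitarily equivalent to the commuting tuple $(\mathbb S_1,\dots,\mathbb S_n)$ on the function space $\mathbb H_{\underline S}=H^2(\mathcal D_{S_n^*})\ominus M_{\theta_{S_n}}H^2(\mathcal D_{S_n})$ defined by $$\mathbb S_i=P_{\mathbb H_{\underline S}}T_{Y_i+zY_{n-i}^*}|_{\mathbb H_{\underline S}}\ (1\le i\le n-1),\qquad \mathbb S_n=P_{\mathbb H_{\underline S}}T_z|_{\mathbb H_{\underline S}}.$$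
   Context: For a contraction $T$, $D_T=(I-T^*T)^{1/2}$ and $\mathcal D_T=\overline{\mathrm{Ran}}\,D_T$. A tuple $(S_1,\dots,S_n)$ of bounded operators is an Agler-Young contraction (Agler-Young tuple) if $S_n$ is a contraction and there are $X_i\in\mathcal B(\mathcal D_{S_n})$ with $S_i-S_{n-i}^*S_n=D_{S_n}X_iD_{S_n}$ for $i=1,\dots,n-1$. It is pure if $(S_n^* )^m\to0$ strongly as $m\to\infty$. $H^2(\mathcal E)$ is the $\mathcal E$-valued Hardy space on the disc; $T_\varphi$ denotes the Toeplitz operator with operator-valued symbol $\varphi$ (for analytic $\varphi$, multiplication by $\varphi$). The characteristic function of $S_n$ is the $\mathcal B(\mathcal D_{S_n},\mathcal D_{S_n^*})$-valued function $\theta_{S_n}(z)=[-S_n+zD_{S_n^*}(I-zS_n^* )^{-1}D_{S_n}]|_{\mathcal D_{S_n}}$ on $\mathbb D$, and $M_{\theta_{S_n}}:H^2(\mathcal D_{S_n})\to H^2(\mathcal D_{S_n^*})$ is multiplication by it. Two tuples are unitarily equivalent if one unitary simultaneously conjugates corresponding entries.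
   Formalization: The operators S_1,…,S_n are assumed to commute pairwise, which the stated definition of an Agler-Young contraction omits; without this the claim fails (e.g. n=3, S_3=0 on C^2, with S_1, S_2 non-commuting), since the model tuple is claimed to commute. *)

theory Defs
  imports "HOL-Analysis.Analysis"
begin

section \<open>Complex Hilbert spaces and operators\<close>

text \<open>
  The real structure (norm, topology, completeness, real inner product) is that of the library;
  \<open>cinner\<close> is linear in the first argument, and its real part is the library's \<open>inner\<close>,
  so that \<open>cinner x x\<close> is the squared norm.
\<close>

class chilbert_space = real_inner + complete_space +
  fixes scaleC :: "complex \<Rightarrow> 'a \<Rightarrow> 'a" (infixr \<open>*\<^sub>C\<close> 75)
    and cinner :: "'a \<Rightarrow> 'a \<Rightarrow> complex"
  assumes scaleC_add_right: "c *\<^sub>C (x + y) = c *\<^sub>C x + c *\<^sub>C y"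
    and scaleC_add_left: "(c + d) *\<^sub>C x = c *\<^sub>C x + d *\<^sub>C x"
    and scaleC_scaleC: "c *\<^sub>C (d *\<^sub>C x) = (c * d) *\<^sub>C x"
    and scaleC_of_real: "complex_of_real r *\<^sub>C x = r *\<^sub>R x"
    and cinner_commute: "cinner x y = cnj (cinner y x)"
    and cinner_add_left: "cinner (x + y) z = cinner x z + cinner y z"
    and cinner_scaleC_left: "cinner (c *\<^sub>C x) y = c * cinner x y"
    and Re_cinner: "Re (cinner x y) = x \<bullet> y"

instantiation complex :: chilbert_space
begin

definition "scaleC_complex (c :: complex) (x :: complex) = c * x"
definition "cinner_complex (x :: complex) (y :: complex) = x * cnj y"

instance
  by standard
    (simp_all add: scaleC_complex_def cinner_complex_def algebra_simps scaleR_conv_of_real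
      inner_complex_def)

end

lemma cinner_self: "cinner x x = complex_of_real ((norm x)\<^sup>2)"
  for x :: "'a::chilbert_space"
proof (rule complex_eqI)
  show "Re (cinner x x) = Re (complex_of_real ((norm x)\<^sup>2))"
    by (simp add: Re_cinner power2_norm_eq_inner)
  have "Im (cinner x x) = - Im (cinner x x)"
    using arg_cong[OF cinner_commute[of x x], of Im] by simp
  then show "Im (cinner x x) = Im (complex_of_real ((norm x)\<^sup>2))"
    by simp
qed

text \<open>
  An operator on a closed subspace \<open>E\<close> is a function on the ambient type of which only the values
  on \<open>E\<close> matter; \<open>E = UNIV\<close> gives the operators on the whole Hilbert space.
\<close>

definition bounded_op_on :: "'a::chilbert_space set \<Rightarrow> ('a \<Rightarrow> 'a) \<Rightarrow> bool" where
  "bounded_op_on E T \<longleftrightarrow>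
     (\<forall>x\<in>E. T x \<in> E) \<and>
     (\<forall>x\<in>E. \<forall>y\<in>E. T (x + y) = T x + T y) \<and>
     (\<forall>c. \<forall>x\<in>E. T (c *\<^sub>C x) = c *\<^sub>C T x) \<and>
     (\<exists>K. \<forall>x\<in>E. norm (T x) \<le> K * norm x)"

abbreviation bounded_op :: "('a::chilbert_space \<Rightarrow> 'a) \<Rightarrow> bool" where
  "bounded_op \<equiv> bounded_op_on UNIV"

definition adj_on :: "'a::chilbert_space set \<Rightarrow> ('a \<Rightarrow> 'a) \<Rightarrow> 'a \<Rightarrow> 'a" where
  "adj_on E T y = (THE z. z \<in> E \<and> (\<forall>x\<in>E. cinner (T x) y = cinner x z))"

abbreviation adj :: "('a::chilbert_space \<Rightarrow> 'a) \<Rightarrow> 'a \<Rightarrow> 'a" where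
  "adj \<equiv> adj_on UNIV"

definition positive_op :: "('a::chilbert_space \<Rightarrow> 'a) \<Rightarrow> bool" where
  "positive_op T \<longleftrightarrow> bounded_op T \<and> (\<forall>x. cinner (T x) x \<in> \<real>\<^sub>\<ge>\<^sub>0)"

definition op_sqrt :: "('a::chilbert_space \<Rightarrow> 'a) \<Rightarrow> 'a \<Rightarrow> 'a" where
  "op_sqrt A = (THE R. positive_op R \<and> R \<circ> R = A)"

definition contraction_op :: "('a::chilbert_space \<Rightarrow> 'a) \<Rightarrow> bool" where
  "contraction_op T \<longleftrightarrow> bounded_op T \<and> (\<forall>x. norm (T x) \<le> norm x)"

definition isometry_op :: "('a::chilbert_space \<Rightarrow> 'a) \<Rightarrow> bool" where
  "isometry_op T \<longleftrightarrow> bounded_op T \<and> (\<forall>x. norm (T x) = norm x)"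

definition finite_cdim :: "'a::chilbert_space set \<Rightarrow> bool" where
  "finite_cdim E \<longleftrightarrow> (\<exists>B. finite B \<and> module.span scaleC B = E)"

section \<open>Agler-Young contractions\<close>

definition defect_op :: "('a::chilbert_space \<Rightarrow> 'a) \<Rightarrow> 'a \<Rightarrow> 'a" where
  "defect_op T = op_sqrt (\<lambda>x. x - adj T (T x))"

definition defect_space :: "('a::chilbert_space \<Rightarrow> 'a) \<Rightarrow> 'a set" where
  "defect_space T = closure (range (defect_op T))"

text \<open>
  Entries are \<open>S 1, \<dots>, S n\<close>. Tuples are commuting; without this the tuple cannot be unitarily
  equivalent to a commuting model.
\<close>

definition agler_young :: "nat \<Rightarrow> (nat \<Rightarrow> 'a::chilbert_space \<Rightarrow> 'a) \<Rightarrow> bool" where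
  "agler_young n S \<longleftrightarrow>
     (\<forall>i\<in>{1..n}. bounded_op (S i)) \<and>
     (\<forall>i\<in>{1..n}. \<forall>j\<in>{1..n}. S i \<circ> S j = S j \<circ> S i) \<and>
     contraction_op (S n) \<and>
     (\<exists>X. \<forall>i\<in>{1..<n}. bounded_op_on (defect_space (S n)) (X i) \<and>
        (\<forall>x. S i x - adj (S (n - i)) (S n x) = defect_op (S n) (X i (defect_op (S n) x))))"

definition pure_tuple :: "nat \<Rightarrow> (nat \<Rightarrow> 'a::chilbert_space \<Rightarrow> 'a) \<Rightarrow> bool" where
  "pure_tuple n S \<longleftrightarrow> (\<forall>x. (\<lambda>m. (adj (S n) ^^ m) x) \<longlonglongrightarrow> 0)"

section \<open>Vector-valued Hardy space\<close>

text \<open>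
  \<open>hardy E\<close> is \<open>H\<^sup>2(E)\<close>: the functions on the open unit disc with a power series whose coefficients
  lie in \<open>E\<close> and are square-summable in norm. Functions on the disc are extended by \<open>0\<close> to all
  of \<open>complex\<close>, so that equality of functions is equality on the disc.
\<close>

definition hardy :: "'a::chilbert_space set \<Rightarrow> (complex \<Rightarrow> 'a) set" where
  "hardy E = {f. \<exists>a. (\<forall>k. a k \<in> E) \<and> summable (\<lambda>k. (norm (a k))\<^sup>2) \<and>
     (\<forall>z\<in>ball 0 1. (\<lambda>k. z ^ k *\<^sub>C a k) sums f z) \<and> (\<forall>z. z \<notin> ball 0 1 \<longrightarrow> f z = 0)}"

definition taylor_coeff :: "(complex \<Rightarrow> 'a::chilbert_space) \<Rightarrow> nat \<Rightarrow> 'a" where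
  "taylor_coeff f = (THE a. \<forall>z\<in>ball 0 1. (\<lambda>k. z ^ k *\<^sub>C a k) sums f z)"

definition hardy_inner :: "(complex \<Rightarrow> 'a::chilbert_space) \<Rightarrow> (complex \<Rightarrow> 'a) \<Rightarrow> complex" where
  "hardy_inner f g = (\<Sum>k. cinner (taylor_coeff f k) (taylor_coeff g k))"

definition orth_compl ::
  "(complex \<Rightarrow> 'a::chilbert_space) set \<Rightarrow> (complex \<Rightarrow> 'a) set \<Rightarrow> (complex \<Rightarrow> 'a) set"
  (infixl \<open>\<ominus>\<^sub>H\<close> 65) where
  "K \<ominus>\<^sub>H M = {f\<in>K. \<forall>g\<in>M. hardy_inner f g = 0}"

definition hardy_proj ::
  "(complex \<Rightarrow> 'a::chilbert_space) set \<Rightarrow> (complex \<Rightarrow> 'a) \<Rightarrow> complex \<Rightarrow> 'a" where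
  "hardy_proj M f = (THE p. p \<in> M \<and> (\<forall>g\<in>M. hardy_inner (\<lambda>z. f z - p z) g = 0))"

text \<open>Multiplication by \<open>\<phi>\<close>; for analytic \<open>\<phi>\<close> this is the Toeplitz operator with symbol \<open>\<phi>\<close>.\<close>

definition mult_op ::
  "(complex \<Rightarrow> 'a \<Rightarrow> 'a) \<Rightarrow> (complex \<Rightarrow> 'a) \<Rightarrow> complex \<Rightarrow> 'a::chilbert_space" where
  "mult_op \<phi> f = (\<lambda>z. if z \<in> ball 0 1 then \<phi> z (f z) else 0)"

section \<open>The functional model\<close>

text \<open>The characteristic function; it is only applied to vectors of \<open>defect_space T\<close>.\<close>

definition char_fun :: "('a::chilbert_space \<Rightarrow> 'a) \<Rightarrow> complex \<Rightarrow> 'a \<Rightarrow> 'a" where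
  "char_fun T z x =
     - T x + z *\<^sub>C defect_op (adj T) (inv (\<lambda>y. y - z *\<^sub>C adj T y) (defect_op T x))"

definition model_space :: "('a::chilbert_space \<Rightarrow> 'a) \<Rightarrow> (complex \<Rightarrow> 'a) set" where
  "model_space T =
     hardy (defect_space (adj T)) \<ominus>\<^sub>H mult_op (char_fun T) ` hardy (defect_space T)"

definition model_tuple ::
  "nat \<Rightarrow> ('a::chilbert_space \<Rightarrow> 'a) \<Rightarrow> (nat \<Rightarrow> 'a \<Rightarrow> 'a) \<Rightarrow>
   nat \<Rightarrow> (complex \<Rightarrow> 'a) \<Rightarrow> complex \<Rightarrow> 'a" where
  "model_tuple n T Y i f =
     hardy_proj (model_space T)
       (mult_op (\<lambda>z x. if i < n
                       then Y i x + z *\<^sub>C adj_on (defect_space (adj T)) (Y (n - i)) x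
                       else z *\<^sub>C x) f)"

definition commuting_on ::
  "nat \<Rightarrow> (complex \<Rightarrow> 'a) set \<Rightarrow> (nat \<Rightarrow> (complex \<Rightarrow> 'a) \<Rightarrow> complex \<Rightarrow> 'a) \<Rightarrow> bool" where
  "commuting_on n M R \<longleftrightarrow>
     (\<forall>i\<in>{1..n}. \<forall>f\<in>M. R i f \<in> M) \<and>
     (\<forall>i\<in>{1..n}. \<forall>j\<in>{1..n}. \<forall>f\<in>M. R i (R j f) = R j (R i f))"

definition unitary_onto :: "(complex \<Rightarrow> 'a) set \<Rightarrow> ('a::chilbert_space \<Rightarrow> complex \<Rightarrow> 'a) \<Rightarrow> bool" where
  "unitary_onto M U \<longleftrightarrow>
     bij_betw U UNIV M \<and>
     (\<forall>x y. U (x + y) = (\<lambda>z. U x z + U y z)) \<and>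
     (\<forall>c x. U (c *\<^sub>C x) = (\<lambda>z. c *\<^sub>C U x z)) \<and>
     (\<forall>x y. hardy_inner (U x) (U y) = cinner x y)"

definition unitarily_equivalent ::
  "nat \<Rightarrow> (nat \<Rightarrow> 'a::chilbert_space \<Rightarrow> 'a) \<Rightarrow>
   (complex \<Rightarrow> 'a) set \<Rightarrow> (nat \<Rightarrow> (complex \<Rightarrow> 'a) \<Rightarrow> complex \<Rightarrow> 'a) \<Rightarrow> bool" where
  "unitarily_equivalent n S M R \<longleftrightarrow>
     (\<exists>U. unitary_onto M U \<and> (\<forall>i\<in>{1..n}. \<forall>x. U (S i x) = R i (U x)))"

end

theory Submission
  imports Defs
begin

text \<open>
  Write \<open>T = S n\<close>, \<open>A = T\<^sup>*\<close>, and \<open>D\<close>, \<open>Ds\<close> for the defect operators of \<open>T\<close> and \<open>A\<close>. As \<open>A\<^sup>m \<rightarrow> 0\<close>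
  strongly, \<open>h \<mapsto> (\<Sum>k. z\<^sup>k Ds A\<^sup>k h)\<close> is an isometry into the Hardy space; its range is the model
  space since \<open>A\<close>, \<open>D\<close>, \<open>Ds\<close>, \<open>- T\<close> are the blocks of a unitary colligation whose transfer function is
  the characteristic function. Where \<open>Ds\<close> vanishes, \<open>T\<close> is inverted isometrically by \<open>A\<close>, and the
  Agler-Young equations force \<open>S i - T S (n - i)\<^sup>*\<close> and its adjoint to vanish as well; as \<open>Ds\<close> has
  finite rank, \<open>S i - T S (n - i)\<^sup>* = Ds (Y i) Ds\<close> for some bounded \<open>Y i\<close>. With these \<open>Y i\<close> the inner
  products of \<open>(Y i + z (Y (n - i))\<^sup>*) (\<Sum>k. z\<^sup>k Ds A\<^sup>k h)\<close> with \<open>\<Sum>k. z\<^sup>k Ds A\<^sup>k g\<close> telescope to the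
  inner product of \<open>S i h\<close> and \<open>g\<close>.
\<close>

section \<open>Operators on a complex Hilbert space\<close>

text \<open>The hypothesis factors \<open>S i - adj (S (n - i)) T\<close> through \<open>D\<close>,
  while the model lives over \<open>Ds\<close>. For operators of infinite rank, vanishing on the
  kernel of \<open>Ds\<close> does not yield a bounded \<open>Y\<close>; finite rank makes the range
  of \<open>Ds\<close> closed, so that kernel conditions on an operator and on its adjoint suffice
  and \<open>Y\<close> comes from a pseudo-inverse. Commutation of \<open>S i\<close> with
  \<open>T\<close> enters in checking one of these conditions. The symbol with entries
  \<open>Y i\<close> and the adjoint of \<open>Y (n - i)\<close> combines the equation for
  \<open>i\<close> with the adjoint of the equation for \<open>n - i\<close>. Each leaves a
  remainder, and the remainders cancel between adjacent powers of \<open>A\<close>; this is why a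
  symbol of degree one in \<open>z\<close> is enough. Commutation of the model is inherited through
  the unitary rather than computed from the symbols. Adjoints, square roots, Taylor coefficients and
  projections are definite descriptions, so existence and uniqueness have to precede any computation
  with them.\<close>

instance chilbert_space \<subseteq> banach ..

lemma scaleC_one: "1 *\<^sub>C x = x" for x :: "'a::chilbert_space"
  using scaleC_of_real[of 1 x] by simp

interpretation cvs: vector_space "scaleC :: complex \<Rightarrow> 'a::chilbert_space \<Rightarrow> 'a"
  by unfold_locales (simp_all add: scaleC_add_right scaleC_add_left scaleC_scaleC scaleC_one)

lemma cinner_add_right: "cinner x (y + z) = cinner x y + cinner x z"
  by (metis cinner_add_left cinner_commute complex_cnj_add)

lemma cinner_scaleC_right: "cinner x (c *\<^sub>C y) = cnj c * cinner x y"
  by (metis cinner_scaleC_left cinner_commute complex_cnj_mult)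

lemma cinner_zero_left [simp]: "cinner 0 y = 0"
  using cinner_add_left[of 0 0 y] by simp

lemma cinner_zero_right [simp]: "cinner x 0 = 0"
  using cinner_add_right[of x 0 0] by simp

lemma cinner_minus_left [simp]: "cinner (- x) y = - cinner x y"
  using cinner_add_left[of x "- x" y] by (simp add: add_eq_0_iff)

lemma cinner_minus_right [simp]: "cinner x (- y) = - cinner x y"
  using cinner_add_right[of x y "- y"] by (simp add: add_eq_0_iff)

lemma cinner_diff_left: "cinner (x - y) z = cinner x z - cinner y z"
  using cinner_add_left[of x "- y" z] by simp

lemma cinner_diff_right: "cinner x (y - z) = cinner x y - cinner x z"
  using cinner_add_right[of x y "- z"] by simp

lemma cinner_scaleR_left: "cinner (r *\<^sub>R x) y = r *\<^sub>R cinner x y"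
  by (metis cinner_scaleC_left scaleC_of_real scaleR_conv_of_real)

lemma cinner_scaleR_right: "cinner x (r *\<^sub>R y) = r *\<^sub>R cinner x y"
  by (metis cinner_scaleC_right complex_cnj_complex_of_real scaleC_of_real scaleR_conv_of_real)

lemma cinner_sum_left: "cinner (sum f I) y = (\<Sum>i\<in>I. cinner (f i) y)"
  by (induction I rule: infinite_finite_induct) (simp_all add: cinner_add_left)

lemma cinner_self_eq_0 [simp]: "cinner x x = 0 \<longleftrightarrow> x = 0"
  by (simp add: cinner_self)

lemma norm_scaleC: "norm (c *\<^sub>C x) = cmod c * norm x"
proof -
  have "complex_of_real ((norm (c *\<^sub>C x))\<^sup>2) = c * cnj c * cinner x x"
    by (simp only: cinner_self[symmetric] cinner_scaleC_left cinner_scaleC_right mult_ac)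
  also have "\<dots> = complex_of_real ((cmod c * norm x)\<^sup>2)"
    by (simp add: cinner_self power_mult_distrib flip: complex_norm_square)
  finally have "(norm (c *\<^sub>C x))\<^sup>2 = (cmod c * norm x)\<^sup>2"
    using of_real_eq_iff by blast
  then show ?thesis
    by simp
qed

text \<open>Multiplying \<open>x\<close> by a unimodular scalar makes the inner product equal to its
  modulus, so the real Cauchy-Schwarz inequality applies.\<close>

lemma norm_cinner_le: "cmod (cinner x y) \<le> norm x * norm y"
proof (cases "cinner x y = 0")
  case False
  define c where "c = cnj (cinner x y) / cmod (cinner x y)"
  have c: "cmod c = 1"
    using False by (simp add: c_def norm_divide)
  have "cinner (c *\<^sub>C x) y = cmod (cinner x y)"
    using False by (simp add: c_def cinner_scaleC_left complex_norm_square[symmetric]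
        mult.commute power2_eq_square)
  then have "cmod (cinner x y) = (c *\<^sub>C x) \<bullet> y"
    by (metis Re_cinner Re_complex_of_real)
  also have "\<dots> \<le> norm (c *\<^sub>C x) * norm y"
    by (rule norm_cauchy_schwarz)
  finally show ?thesis
    by (simp add: norm_scaleC c)
qed simp

lemma bounded_bilinear_cinner: "bounded_bilinear cinner"
proof
  show "\<exists>K. \<forall>a b. norm (cinner a b) \<le> norm a * norm b * K"
    by (rule exI[of _ 1]) (simp add: norm_cinner_le)
qed (simp_all add: cinner_add_left cinner_add_right cinner_scaleR_left cinner_scaleR_right)

lemmas tendsto_cinner = bounded_bilinear.tendsto[OF bounded_bilinear_cinner]

lemma bounded_bilinear_scaleC: "bounded_bilinear (scaleC :: complex \<Rightarrow> 'a::chilbert_space \<Rightarrow> 'a)"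
proof
  fix r :: real and a :: complex and b :: 'a
  show "(r *\<^sub>R a) *\<^sub>C b = r *\<^sub>R (a *\<^sub>C b)"
    by (simp add: scaleC_scaleC scaleR_conv_of_real flip: scaleC_of_real)
  show "a *\<^sub>C (r *\<^sub>R b) = r *\<^sub>R (a *\<^sub>C b)"
    by (simp add: scaleC_scaleC mult.commute flip: scaleC_of_real)
  show "\<exists>K. \<forall>(a::complex) (b::'a). norm (a *\<^sub>C b) \<le> norm a * norm b * K"
    by (rule exI[of _ 1]) (simp add: norm_scaleC)
qed (simp_all add: scaleC_add_right scaleC_add_left)

lemma cinner_eqI: "(\<And>x. cinner x y = cinner x z) \<Longrightarrow> y = z"
  by (metis cinner_diff_right cinner_self_eq_0 eq_iff_diff_eq_0)

section \<open>Riesz representation on closed subspaces\<close>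

lemma csubspace_imp_subspace: "cvs.subspace E \<Longrightarrow> subspace E"
  by (metis cvs.subspace_0 cvs.subspace_add cvs.subspace_scale scaleC_of_real subspaceI)

text \<open>If \<open>z\<close> represents \<open>f\<close>, then
  \<open>J x = (norm (x - z))^2 - (norm z)^2\<close>, so \<open>z\<close> has to be the minimizer of
  \<open>J\<close>. Completeness supplies one, because the parallelogram law makes a minimizing
  sequence Cauchy; the first variation of \<open>J\<close> at the minimizer then vanishes.\<close>

lemma riesz_real:
  fixes E :: "'a::{real_inner,complete_space} set"
  assumes E: "subspace E" "closed E"
    and add: "\<And>x y. x \<in> E \<Longrightarrow> y \<in> E \<Longrightarrow> f (x + y) = f x + f y"
    and scale: "\<And>r x. x \<in> E \<Longrightarrow> f (r *\<^sub>R x) = r * f x"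
    and bound: "\<And>x. x \<in> E \<Longrightarrow> \<bar>f x\<bar> \<le> K * norm x"
  shows "\<exists>z\<in>E. \<forall>x\<in>E. f x = x \<bullet> z"
proof -
  define J where "J x = (norm x)\<^sup>2 - 2 * f x" for x
  have lower: "- (K\<^sup>2) \<le> J x" if "x \<in> E" for x
  proof -
    have "0 \<le> (norm x - K)\<^sup>2"
      by simp
    then show ?thesis
      using bound[OF that] unfolding J_def by (simp add: power2_eq_square algebra_simps)
  qed
  have bdd: "bdd_below (J ` E)"
    using lower by (intro bdd_belowI[of _ "- (K\<^sup>2)"]) auto
  have ne: "J ` E \<noteq> {}"
    using subspace_0[OF E(1)] by auto
  define m where "m = Inf (J ` E)"
  have m_le: "m \<le> J x" if "x \<in> E" for x
    unfolding m_def using bdd that by (simp add: cINF_lower)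
  define d where "d k = 1 / real (Suc k)" for k
  have "\<exists>x\<in>E. J x < m + d k" for k
    using cInf_lessD[OF ne, of "m + d k"] by (auto simp: m_def d_def)
  then obtain w where wE: "w k \<in> E" and w: "J (w k) < m + d k" for k
    by metis
  have par: "(norm (x - y))\<^sup>2 \<le> 2 * (J x + J y - 2 * m)" if "x \<in> E" "y \<in> E" for x y
  proof -
    \<comment> \<open>The midpoint lies in \<open>E\<close>, so \<open>J\<close> is at least
      \<open>m\<close> there; the parallelogram law turns this into a bound on the distance of
      \<open>x\<close> and \<open>y\<close>.\<close>
    have "(1/2) *\<^sub>R (x + y) \<in> E"
      using that E(1) by (simp add: subspace_add subspace_scale)
    then have "m \<le> J ((1/2) *\<^sub>R (x + y))"
      by (rule m_le)
    moreover have "J ((1/2) *\<^sub>R (x + y)) = (norm (x + y))\<^sup>2 / 4 - (f x + f y)"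
      using that E(1)
      by (simp add: J_def scale[of "x + y"] add subspace_add power_divide add_divide_distrib
          del: scaleR_add_right)
    moreover have "(norm (x - y))\<^sup>2 + (norm (x + y))\<^sup>2 = 2 * (norm x)\<^sup>2 + 2 * (norm y)\<^sup>2"
      by (simp add: power2_norm_eq_inner inner_simps inner_commute)
    ultimately show ?thesis
      by (simp add: J_def)
  qed
  have "Cauchy w"
    unfolding Cauchy_altdef2
  proof (intro allI impI)
    fix e :: real
    assume e: "0 < e"
    obtain N where N: "d N < e\<^sup>2 / 4"
      using nat_approx_posE[of "e\<^sup>2 / 4"] e by (auto simp: d_def)
    have "dist (w n) (w N) < e" if "N \<le> n" for n
    proof -
      have "d n \<le> d N"
        using that by (simp add: d_def frac_le)
      then have "(norm (w n - w N))\<^sup>2 < e\<^sup>2"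
        using par[OF wE[of n] wE[of N]] w[of n] w[of N] N by argo
      then show ?thesis
        using e by (simp add: dist_norm power_less_imp_less_base)
    qed
    then show "\<exists>N. \<forall>n\<ge>N. dist (w n) (w N) < e"
      by blast
  qed
  then obtain z where z: "w \<longlonglongrightarrow> z"
    using Cauchy_convergent_iff convergent_def by blast
  have zE: "z \<in> E"
    using closed_sequentially[OF E(2)] wE z by blast
  have "(\<lambda>k. f (w k)) \<longlonglongrightarrow> f z"
  proof (rule LIM_zero_cancel, rule Lim_null_comparison)
    have "f (w k) - f z = f (w k - z)" for k
      using add[of "w k - z" z] wE zE E(1) by (simp add: subspace_diff)
    then show "\<forall>\<^sub>F k in sequentially. norm (f (w k) - f z) \<le> K * norm (w k - z)"
      using bound wE zE E(1) by (simp add: subspace_diff)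
    show "(\<lambda>k. K * norm (w k - z)) \<longlonglongrightarrow> 0"
      using tendsto_mult_left[OF tendsto_norm[OF LIM_zero[OF z]], of K] by simp
  qed
  then have Jlim: "(\<lambda>k. J (w k)) \<longlonglongrightarrow> J z"
    unfolding J_def by (intro tendsto_intros z)
  have "(\<lambda>k. m + d k) \<longlonglongrightarrow> m + 0"
    unfolding d_def by (intro tendsto_intros LIMSEQ_Suc lim_const_over_n)
  then have "J z \<le> m"
    using LIMSEQ_le[OF Jlim] w by (metis add_0_right less_imp_le)
  have "f x = x \<bullet> z" if x: "x \<in> E" for x
  proof -
    have q: "0 \<le> 2 * t * (x \<bullet> z - f x) + t\<^sup>2 * (norm x)\<^sup>2" for t
    proof -
      have "(norm (z + t *\<^sub>R x))\<^sup>2 = (norm z)\<^sup>2 + 2 * t * (x \<bullet> z) + t\<^sup>2 * (norm x)\<^sup>2"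
        unfolding power2_norm_eq_inner
        by (simp add: inner_simps inner_commute power2_eq_square)
      then have "J (z + t *\<^sub>R x) = J z + (2 * t * (x \<bullet> z - f x) + t\<^sup>2 * (norm x)\<^sup>2)"
        using x zE E(1) by (simp add: J_def add scale subspace_scale algebra_simps)
      moreover have "J z \<le> J (z + t *\<^sub>R x)"
        using \<open>J z \<le> m\<close> m_le[of "z + t *\<^sub>R x"] x zE E(1)
        by (simp add: subspace_add subspace_scale order_trans)
      ultimately show ?thesis
        by simp
    qed
    define c where "c = x \<bullet> z - f x"
    \<comment> \<open>The optimal step \<open>- c / (norm x)^2\<close> would exclude
      \<open>x = 0\<close>. Enlarging the denominator by 1 avoids that case and still makes the
      quadratic negative unless \<open>c = 0\<close>.\<close>
    define s where "s = 1 + (norm x)\<^sup>2"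
    have s: "s > 0" "(norm x)\<^sup>2 = s - 1"
      by (simp_all add: s_def add_pos_nonneg)
    have "0 \<le> 2 * (- c / s) * c + (- c / s)\<^sup>2 * (s - 1)"
      using q[of "- c / s"] by (simp add: c_def s(2))
    also have "\<dots> = - (c\<^sup>2) * (s + 1) / s\<^sup>2"
      using s(1) by (simp add: field_simps power2_eq_square)
    finally have "c\<^sup>2 * (s + 1) \<le> 0"
      using s(1) by (simp add: divide_le_0_iff zero_le_divide_iff)
    then have "c = 0"
      using s(1) by (simp add: mult_le_0_iff)
    then show ?thesis
      by (simp add: c_def)
  qed
  then show ?thesis
    using zE by blast
qed

text \<open>A complex linear functional is determined by its real part: its imaginary part at
  \<open>x\<close> is minus its real part at \<open>\<i> *\<^sub>C x\<close>.\<close>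

lemma riesz:
  fixes E :: "'a::chilbert_space set"
  assumes E: "cvs.subspace E" "closed E"
    and add: "\<And>x y. x \<in> E \<Longrightarrow> y \<in> E \<Longrightarrow> f (x + y) = f x + f y"
    and scale: "\<And>c x. x \<in> E \<Longrightarrow> f (c *\<^sub>C x) = c * f x"
    and bound: "\<And>x. x \<in> E \<Longrightarrow> cmod (f x) \<le> K * norm x"
  shows "\<exists>z\<in>E. \<forall>x\<in>E. f x = cinner x z"
proof -
  have "\<exists>z\<in>E. \<forall>x\<in>E. Re (f x) = x \<bullet> z"
  proof (rule riesz_real[where K = K])
    fix r x
    assume "x \<in> E"
    then show "Re (f (r *\<^sub>R x)) = r * Re (f x)"
      by (simp add: scale flip: scaleC_of_real)
  next
    fix x
    assume "x \<in> E"
    then show "\<bar>Re (f x)\<bar> \<le> K * norm x"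
      using bound abs_Re_le_cmod order_trans by blast
  qed (simp_all add: E csubspace_imp_subspace add)
  then obtain z where z: "z \<in> E" "\<And>x. x \<in> E \<Longrightarrow> Re (f x) = Re (cinner x z)"
    by (auto simp: Re_cinner)
  have "f x = cinner x z" if "x \<in> E" for x
  proof (rule complex_eqI)
    show "Re (f x) = Re (cinner x z)"
      using z that by blast
    have "Re (f (\<i> *\<^sub>C x)) = Re (cinner (\<i> *\<^sub>C x) z)"
      using z that E(1) by (simp add: cvs.subspace_scale)
    then show "Im (f x) = Im (cinner x z)"
      using that by (simp add: scale cinner_scaleC_left)
  qed
  then show ?thesis
    using z(1) by blast
qed

section \<open>Bounded operators on closed subspaces and their adjoints\<close>

lemma bounded_op_onD:
  assumes "bounded_op_on E T"
  shows "x \<in> E \<Longrightarrow> T x \<in> E"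
    and "x \<in> E \<Longrightarrow> y \<in> E \<Longrightarrow> T (x + y) = T x + T y"
    and "x \<in> E \<Longrightarrow> T (c *\<^sub>C x) = c *\<^sub>C T x"
  using assms unfolding bounded_op_on_def by blast+

lemma bounded_op_on_bound:
  assumes "bounded_op_on E T"
  obtains K where "0 \<le> K" "\<And>x. x \<in> E \<Longrightarrow> norm (T x) \<le> K * norm x"
proof -
  obtain K where K: "\<And>x. x \<in> E \<Longrightarrow> norm (T x) \<le> K * norm x"
    using assms unfolding bounded_op_on_def by blast
  show ?thesis
  \<comment> \<open>On the trivial subspace the constant in \<open>bounded_op_on\<close> may be
    negative.\<close>
  proof (rule that[of "max 0 K"])
    fix x
    assume "x \<in> E"
    then show "norm (T x) \<le> max 0 K * norm x"
      by (meson K max.cobounded2 mult_right_mono norm_ge_zero order_trans)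
  qed simp
qed

lemma bounded_op_bounded_linear:
  assumes "bounded_op T"
  shows "bounded_linear T"
proof -
  obtain K where "\<And>x. norm (T x) \<le> K * norm x"
    using bounded_op_on_bound[OF assms] by auto
  then show ?thesis
    using bounded_op_onD(2,3)[OF assms]
    by (intro bounded_linear_intro[of _ K])
      (simp_all add: mult.commute flip: scaleC_of_real)
qed

lemma adj_on_existence:
  assumes E: "cvs.subspace E" "closed E" and T: "bounded_op_on E T" and y: "y \<in> E"
  shows "\<exists>!z. z \<in> E \<and> (\<forall>x\<in>E. cinner (T x) y = cinner x z)"
proof (rule ex_ex1I)
  obtain K where K: "0 \<le> K" "\<And>x. x \<in> E \<Longrightarrow> norm (T x) \<le> K * norm x"
    using bounded_op_on_bound[OF T] by blast
  have "\<exists>z\<in>E. \<forall>x\<in>E. cinner (T x) y = cinner x z"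
  proof (rule riesz[OF E, where K = "K * norm y"])
    fix x
    assume "x \<in> E"
    have "cmod (cinner (T x) y) \<le> norm (T x) * norm y"
      by (rule norm_cinner_le)
    also have "\<dots> \<le> K * norm x * norm y"
      using K \<open>x \<in> E\<close> by (simp add: mult_right_mono)
    finally show "cmod (cinner (T x) y) \<le> K * norm y * norm x"
      by (simp add: mult_ac)
  qed (simp_all add: bounded_op_onD[OF T] cinner_add_left cinner_scaleC_left)
  then show "\<exists>z. z \<in> E \<and> (\<forall>x\<in>E. cinner (T x) y = cinner x z)"
    by blast
next
  fix z w
  assume z: "z \<in> E \<and> (\<forall>x\<in>E. cinner (T x) y = cinner x z)"
    and w: "w \<in> E \<and> (\<forall>x\<in>E. cinner (T x) y = cinner x w)"
  have "z - w \<in> E"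
    using z w E(1) by (simp add: cvs.subspace_diff)
  then have "cinner (z - w) (z - w) = 0"
    using z w by (metis cinner_diff_right right_minus_eq)
  then show "z = w"
    by simp
qed

lemma adj_on:
  assumes "cvs.subspace E" "closed E" "bounded_op_on E T" "y \<in> E"
  shows adj_on_in: "adj_on E T y \<in> E"
    and cinner_adj_on: "x \<in> E \<Longrightarrow> cinner (T x) y = cinner x (adj_on E T y)"
  using theI'[OF adj_on_existence[OF assms]] unfolding adj_on_def by blast+

lemma adj_on_unique:
  assumes "cvs.subspace E" "closed E" "bounded_op_on E T" "y \<in> E"
    and "z \<in> E" "\<And>x. x \<in> E \<Longrightarrow> cinner (T x) y = cinner x z"
  shows "adj_on E T y = z"
  using adj_on_existence[OF assms(1-4)] adj_on[OF assms(1-4)] assms(5,6) by blast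

lemma bounded_op_on_adj_on:
  assumes E: "cvs.subspace E" "closed E" and T: "bounded_op_on E T"
  shows "bounded_op_on E (adj_on E T)"
proof -
  note a = adj_on[OF E T]
  obtain K where K: "0 \<le> K" "\<And>x. x \<in> E \<Longrightarrow> norm (T x) \<le> K * norm x"
    using bounded_op_on_bound[OF T] by blast
  have "norm (adj_on E T y) \<le> K * norm y" if y: "y \<in> E" for y
  proof (cases "adj_on E T y = 0")
    case False
    let ?z = "adj_on E T y"
    have "complex_of_real ((norm ?z)\<^sup>2) = cinner (T ?z) y"
      using a[OF y] by (simp add: cinner_self)
    then have "(norm ?z)\<^sup>2 = cmod (cinner (T ?z) y)"
      by (metis norm_of_real abs_power2)
    also have "\<dots> \<le> norm (T ?z) * norm y"
      by (rule norm_cinner_le)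
    also have "\<dots> \<le> K * norm ?z * norm y"
      using K(2)[OF a(1)[OF y]] by (simp add: mult_right_mono)
    finally have "norm ?z * norm ?z \<le> norm ?z * (K * norm y)"
      by (simp add: power2_eq_square mult_ac)
    then show ?thesis
      using False by simp
  qed (simp add: K)
  moreover have "adj_on E T (x + y) = adj_on E T x + adj_on E T y" if "x \<in> E" "y \<in> E" for x y
    using that a E(1)
    by (intro adj_on_unique[OF E T]) (simp_all add: cvs.subspace_add cinner_add_right)
  moreover have "adj_on E T (c *\<^sub>C x) = c *\<^sub>C adj_on E T x" if "x \<in> E" for x c
    using that a E(1)
    by (intro adj_on_unique[OF E T]) (simp_all add: cvs.subspace_scale cinner_scaleC_right)
  ultimately show ?thesis
    unfolding bounded_op_on_def using a(1) by blast
qed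

context
  fixes T :: "'a::chilbert_space \<Rightarrow> 'a"
  assumes T: "bounded_op T"
begin

lemma cinner_adj_right: "cinner x (adj T y) = cinner (T x) y"
  using cinner_adj_on[of UNIV T y x] T by simp

lemma cinner_adj_left: "cinner (adj T x) y = cinner x (T y)"
  by (metis cinner_adj_right cinner_commute)

lemma bounded_op_adj: "bounded_op (adj T)"
  using bounded_op_on_adj_on[of UNIV T] T by simp

lemma adj_eqI: "(\<And>x y. cinner (T x) y = cinner x (R y)) \<Longrightarrow> adj T = R"
  by (metis cinner_adj_right cinner_eqI ext)

end

lemma adj_adj: "bounded_op T \<Longrightarrow> adj (adj T) = T"
  by (simp add: adj_eqI bounded_op_adj cinner_adj_left)

lemma contraction_op_adj:
  assumes "contraction_op T"
  shows "contraction_op (adj T)"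
proof -
  have T: "bounded_op T" and le: "\<And>x. norm (T x) \<le> norm x"
    using assms by (auto simp: contraction_op_def)
  have "norm (adj T y) \<le> norm y" for y
  proof (cases "adj T y = 0")
    case False
    have "complex_of_real ((norm (adj T y))\<^sup>2) = cinner (T (adj T y)) y"
      using T by (simp add: cinner_self flip: cinner_adj_right)
    then have "(norm (adj T y))\<^sup>2 = cmod (cinner (T (adj T y)) y)"
      by (metis norm_of_real abs_power2)
    also have "\<dots> \<le> norm (T (adj T y)) * norm y"
      by (rule norm_cinner_le)
    also have "\<dots> \<le> norm (adj T y) * norm y"
      by (simp add: le mult_right_mono)
    finally show ?thesis
      using False by (simp add: power2_eq_square)
  qed simp
  then show ?thesis
    using T by (simp add: contraction_op_def bounded_op_adj)
qed

section \<open>Square roots and defect operators\<close>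

text \<open>
  For a contraction \<open>C\<close> the iteration \<open>Y' = (C + Y\<^sup>2) / 2\<close> converges to a solution \<open>Z\<close>
  of \<open>(I - Z)\<^sup>2 = I - C\<close>; the increments are dominated by those of the same scalar iteration
  for \<open>C = 1\<close>.
\<close>

fun sqrt_iter :: "('a::chilbert_space \<Rightarrow> 'a) \<Rightarrow> nat \<Rightarrow> 'a \<Rightarrow> 'a" where
  "sqrt_iter C 0 x = 0"
| "sqrt_iter C (Suc k) x = (1/2) *\<^sub>R (C x + sqrt_iter C k (sqrt_iter C k x))"

fun sqrt_majorant :: "nat \<Rightarrow> real" where
  "sqrt_majorant 0 = 0"
| "sqrt_majorant (Suc k) = (1 + (sqrt_majorant k)\<^sup>2) / 2"

definition sqrt_limit :: "('a::chilbert_space \<Rightarrow> 'a) \<Rightarrow> 'a \<Rightarrow> 'a" where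
  "sqrt_limit C x = lim (\<lambda>k. sqrt_iter C k x)"

lemma sqrt_majorant_nonneg: "0 \<le> sqrt_majorant k"
  by (cases k) (auto simp: add_nonneg_nonneg)

lemma sqrt_majorant_le_1: "sqrt_majorant k \<le> 1"
proof (induction k)
  case (Suc k)
  then have "(sqrt_majorant k)\<^sup>2 \<le> 1"
    by (simp add: sqrt_majorant_nonneg power_le_one)
  then show ?case
    by simp
qed simp

text \<open>Scalar counterpart of the splitting in \<open>norm_sqrt_iter_increment\<close>; it
  closes the induction there and gives monotonicity here.\<close>

lemma sqrt_majorant_increment:
  "sqrt_majorant (Suc (Suc k)) - sqrt_majorant (Suc k) =
     (sqrt_majorant (Suc k) + sqrt_majorant k) * (sqrt_majorant (Suc k) - sqrt_majorant k) / 2"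
proof -
  have "(1 + (sqrt_majorant (Suc k))\<^sup>2) / 2 - (1 + (sqrt_majorant k)\<^sup>2) / 2 =
     (sqrt_majorant (Suc k) + sqrt_majorant k) * (sqrt_majorant (Suc k) - sqrt_majorant k) / 2"
    by (simp only: power2_eq_square algebra_simps diff_divide_distrib add_divide_distrib)
  then show ?thesis
    by (metis sqrt_majorant.simps(2))
qed

lemma sqrt_majorant_Suc_le: "sqrt_majorant k \<le> sqrt_majorant (Suc k)"
proof (induction k)
  case (Suc k)
  then have "0 \<le> sqrt_majorant (Suc (Suc k)) - sqrt_majorant (Suc k)"
    unfolding sqrt_majorant_increment by (intro divide_nonneg_pos mult_nonneg_nonneg add_nonneg_nonneg)
      (simp_all add: sqrt_majorant_nonneg del: sqrt_majorant.simps)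
  then show ?case
    by (simp del: sqrt_majorant.simps)
qed simp

lemma Cauchy_sqrt_majorant: "Cauchy sqrt_majorant"
proof (intro convergent_Cauchy Bseq_mono_convergent BseqI'[of _ 1] allI impI)
  show "sqrt_majorant k \<le> sqrt_majorant l" if "k \<le> l" for k l
    by (rule lift_Suc_mono_le[of sqrt_majorant, OF sqrt_majorant_Suc_le that])
qed (simp add: sqrt_majorant_nonneg sqrt_majorant_le_1)

context
  fixes C :: "'a::chilbert_space \<Rightarrow> 'a"
  assumes C: "contraction_op C"
begin

lemma sqrt_iter_add: "sqrt_iter C k (x + y) = sqrt_iter C k x + sqrt_iter C k y"
  using C unfolding contraction_op_def
  by (induction k arbitrary: x y) (simp_all add: bounded_op_onD(2)[of UNIV] scaleR_add_right)

lemma sqrt_iter_diff: "sqrt_iter C k (x - y) = sqrt_iter C k x - sqrt_iter C k y"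
  using sqrt_iter_add[of k "x - y" y] by simp

lemma sqrt_iter_scaleC: "sqrt_iter C k (c *\<^sub>C x) = c *\<^sub>C sqrt_iter C k x"
proof (induction k arbitrary: x)
  case (Suc k)
  have "C (c *\<^sub>C x) = c *\<^sub>C C x"
    using C by (simp add: contraction_op_def bounded_op_onD(3)[of UNIV])
  then show ?case
    by (simp add: Suc scaleC_add_right scaleC_scaleC mult.commute flip: scaleC_of_real)
qed simp

lemma norm_sqrt_iter: "norm (sqrt_iter C k x) \<le> sqrt_majorant k * norm x"
proof (induction k arbitrary: x)
  case (Suc k)
  have "norm (sqrt_iter C k (sqrt_iter C k x)) \<le> sqrt_majorant k * (sqrt_majorant k * norm x)"
    by (meson Suc mult_left_mono order_trans sqrt_majorant_nonneg)
  moreover have "norm (C x) \<le> norm x"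
    using C by (simp add: contraction_op_def)
  ultimately have "norm (C x + sqrt_iter C k (sqrt_iter C k x)) \<le>
      norm x + sqrt_majorant k * (sqrt_majorant k * norm x)"
    by (meson add_mono norm_triangle_ineq order_trans)
  then show ?case
    by (simp add: power2_eq_square algebra_simps del: scaleR_add_right)
qed simp

lemma norm_sqrt_iter_le: "norm (sqrt_iter C k x) \<le> norm x"
  by (meson mult_left_le_one_le norm_ge_zero norm_sqrt_iter order_trans sqrt_majorant_le_1
      sqrt_majorant_nonneg)

text \<open>A difference of operator squares splits as
  \<open>Y' Y' - Y Y = Y' (Y' - Y) + (Y' - Y) Y\<close>. Bounding the factors by the majorant and
  its increment reproduces the scalar recursion.\<close>

lemma norm_sqrt_iter_increment:
  "norm (sqrt_iter C (Suc k) x - sqrt_iter C k x) \<le>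
     (sqrt_majorant (Suc k) - sqrt_majorant k) * norm x"
proof (induction k arbitrary: x)
  case 0
  then show ?case
    using C by (simp add: contraction_op_def)
next
  case (Suc k)
  let ?Y = "sqrt_iter C" and ?y = "sqrt_majorant"
  let ?d = "?y (Suc k) - ?y k"
  have d: "0 \<le> ?d"
    using sqrt_majorant_Suc_le[of k] by (simp del: sqrt_majorant.simps)
  have "norm (?Y (Suc k) (?Y (Suc k) x - ?Y k x)) \<le> ?y (Suc k) * (?d * norm x)"
    by (meson Suc mult_left_mono norm_sqrt_iter order_trans sqrt_majorant_nonneg)
  moreover have "norm (?Y (Suc k) (?Y k x) - ?Y k (?Y k x)) \<le> ?d * (?y k * norm x)"
    by (meson Suc d mult_left_mono norm_sqrt_iter order_trans)
  ultimately have "norm (?Y (Suc k) (?Y (Suc k) x - ?Y k x) + (?Y (Suc k) (?Y k x) - ?Y k (?Y k x)))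
      \<le> ?y (Suc k) * (?d * norm x) + ?d * (?y k * norm x)"
    by (meson add_mono norm_triangle_ineq order_trans)
  moreover have "?Y (Suc (Suc k)) x - ?Y (Suc k) x =
      (1/2) *\<^sub>R (?Y (Suc k) (?Y (Suc k) x - ?Y k x) + (?Y (Suc k) (?Y k x) - ?Y k (?Y k x)))"
    unfolding sqrt_iter_diff sqrt_iter.simps(2)[of C "Suc k" x] sqrt_iter.simps(2)[of C k x]
    by (simp only: scaleR_diff_right[symmetric]) simp
  moreover have "?y (Suc k) * (?d * norm x) + ?d * (?y k * norm x) =
      2 * ((?y (Suc k) + ?y k) * ?d / 2 * norm x)"
    by (simp add: algebra_simps del: sqrt_majorant.simps)
  ultimately show ?case
    unfolding sqrt_majorant_increment
    by (simp del: sqrt_iter.simps sqrt_majorant.simps scaleR_add_right scaleR_diff_right)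
qed

lemma norm_sqrt_iter_diff:
  assumes "k \<le> l"
  shows "norm (sqrt_iter C l x - sqrt_iter C k x) \<le> (sqrt_majorant l - sqrt_majorant k) * norm x"
  using assms
proof (induction l rule: dec_induct)
  case (step l)
  have "norm (sqrt_iter C (Suc l) x - sqrt_iter C k x) \<le>
      norm (sqrt_iter C (Suc l) x - sqrt_iter C l x) + norm (sqrt_iter C l x - sqrt_iter C k x)"
    by (rule norm_diff_triangle_le[OF order_refl order_refl])
  also have "\<dots> \<le> (sqrt_majorant (Suc l) - sqrt_majorant l) * norm x
      + (sqrt_majorant l - sqrt_majorant k) * norm x"
    by (intro add_mono norm_sqrt_iter_increment step.IH)
  finally show ?case
    by (simp add: algebra_simps del: sqrt_iter.simps sqrt_majorant.simps)
qed simp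

lemma sqrt_iter_tendsto: "(\<lambda>k. sqrt_iter C k x) \<longlonglongrightarrow> sqrt_limit C x"
proof -
  have "Cauchy (\<lambda>k. sqrt_iter C k x)"
  proof (rule metric_CauchyI)
    fix e :: real
    assume "0 < e"
    then have e: "0 < e / (1 + norm x)"
      by (simp add: add_pos_nonneg)
    obtain N where N: "\<And>k l. N \<le> k \<Longrightarrow> N \<le> l \<Longrightarrow>
        \<bar>sqrt_majorant k - sqrt_majorant l\<bar> < e / (1 + norm x)"
      using metric_CauchyD[OF Cauchy_sqrt_majorant e] by (auto simp: dist_real_def)
    have le: "dist (sqrt_iter C l x) (sqrt_iter C k x) < e" if "N \<le> k" "k \<le> l" for k l
    proof -
      have "norm (sqrt_iter C l x - sqrt_iter C k x) \<le> (sqrt_majorant l - sqrt_majorant k) * norm x"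
        using that by (simp add: norm_sqrt_iter_diff)
      also have "\<dots> \<le> e / (1 + norm x) * norm x"
        using N[of l k] that by (intro mult_right_mono) auto
      also have "\<dots> < e"
        using \<open>0 < e\<close> by (simp add: pos_divide_less_eq add_pos_nonneg algebra_simps)
      finally show ?thesis
        by (simp add: dist_norm)
    qed
    show "\<exists>N. \<forall>k\<ge>N. \<forall>l\<ge>N. dist (sqrt_iter C k x) (sqrt_iter C l x) < e"
      by (metis dist_commute le linorder_linear)
  qed
  then show ?thesis
    unfolding sqrt_limit_def by (simp add: Cauchy_convergent convergent_LIMSEQ_iff[symmetric])
qed

lemma sqrt_limit_add: "sqrt_limit C (x + y) = sqrt_limit C x + sqrt_limit C y"
  using tendsto_add[OF sqrt_iter_tendsto[of x] sqrt_iter_tendsto[of y]] sqrt_iter_tendsto[of "x + y"]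
  by (simp add: sqrt_iter_add LIMSEQ_unique)

lemma sqrt_limit_scaleC: "sqrt_limit C (c *\<^sub>C x) = c *\<^sub>C sqrt_limit C x"
  using bounded_bilinear.tendsto[OF bounded_bilinear_scaleC tendsto_const[of c] sqrt_iter_tendsto[of x]]
    sqrt_iter_tendsto[of "c *\<^sub>C x"]
  by (simp add: sqrt_iter_scaleC LIMSEQ_unique)

lemma norm_sqrt_limit: "norm (sqrt_limit C x) \<le> norm x"
  by (rule LIMSEQ_le_const2[OF tendsto_norm[OF sqrt_iter_tendsto]]) (simp add: norm_sqrt_iter_le)

lemma sqrt_limit_fixpoint: "sqrt_limit C x = (1/2) *\<^sub>R (C x + sqrt_limit C (sqrt_limit C x))"
proof -
  let ?Y = "sqrt_iter C" and ?Z = "sqrt_limit C"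
  \<comment> \<open>Strong convergence alone does not pass to the composite
    \<open>?Y k (?Y k x)\<close>; the uniform bound on the iterates does.\<close>
  have "(\<lambda>k. ?Y k (?Y k x - ?Z x)) \<longlonglongrightarrow> 0"
  proof (rule Lim_null_comparison)
    show "\<forall>\<^sub>F k in sequentially. norm (?Y k (?Y k x - ?Z x)) \<le> norm (?Y k x - ?Z x)"
      by (simp add: norm_sqrt_iter_le)
    show "(\<lambda>k. norm (?Y k x - ?Z x)) \<longlonglongrightarrow> 0"
      by (intro tendsto_norm_zero LIM_zero sqrt_iter_tendsto)
  qed
  from tendsto_add[OF this sqrt_iter_tendsto[of "?Z x"]]
  have "(\<lambda>k. ?Y k (?Y k x)) \<longlonglongrightarrow> ?Z (?Z x)"
    by (simp add: sqrt_iter_diff)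
  then have "(\<lambda>k. ?Y (Suc k) x) \<longlonglongrightarrow> (1/2) *\<^sub>R (C x + ?Z (?Z x))"
    unfolding sqrt_iter.simps by (intro tendsto_intros)
  with LIMSEQ_Suc[OF sqrt_iter_tendsto[of x]] show ?thesis
    by (rule LIMSEQ_unique)
qed

lemma cinner_sqrt_limit:
  assumes "\<And>x y. cinner (C x) y = cinner x (C y)"
  shows "cinner (sqrt_limit C x) y = cinner x (sqrt_limit C y)"
proof -
  have "cinner (sqrt_iter C k x) y = cinner x (sqrt_iter C k y)" for k x y
    by (induction k arbitrary: x y)
      (simp_all add: assms cinner_scaleR_left cinner_scaleR_right cinner_add_left cinner_add_right)
  then have "(\<lambda>k. cinner x (sqrt_iter C k y)) \<longlonglongrightarrow> cinner (sqrt_limit C x) y"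
    using tendsto_cinner[OF sqrt_iter_tendsto[of x] tendsto_const[of y]] by simp
  moreover have "(\<lambda>k. cinner x (sqrt_iter C k y)) \<longlonglongrightarrow> cinner x (sqrt_limit C y)"
    by (intro tendsto_cinner sqrt_iter_tendsto tendsto_const)
  ultimately show ?thesis
    by (rule LIMSEQ_unique)
qed

end

text \<open>Each iterate is a polynomial in \<open>C\<close>, hence intertwined along with
  \<open>C\<close>. This serves twice: with \<open>V\<close> a competing square root, for
  uniqueness, and with \<open>V = T\<close>, to relate the two defect operators.\<close>

lemma sqrt_limit_intertwining:
  assumes C: "contraction_op C" "contraction_op C'" and V: "bounded_linear V"
    and eq: "\<And>x. V (C x) = C' (V x)"
  shows "V (sqrt_limit C x) = sqrt_limit C' (V x)"
proof -
  interpret V: bounded_linear V by fact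
  have "V (sqrt_iter C k x) = sqrt_iter C' k (V x)" for k x
    by (induction k arbitrary: x) (simp_all add: V.scaleR V.add V.zero eq)
  then have "(\<lambda>k. sqrt_iter C' k (V x)) \<longlonglongrightarrow> V (sqrt_limit C x)"
    using V.tendsto[OF sqrt_iter_tendsto[OF C(1), of x]] by simp
  then show ?thesis
    using sqrt_iter_tendsto[OF C(2)] LIMSEQ_unique by blast
qed

section \<open>Positive operators and uniqueness of the square root\<close>

lemma positive_op_selfadjoint:
  assumes "positive_op R"
  shows "cinner (R x) y = cinner x (R y)"
proof -
  have R: "bounded_op R" and "\<And>x. cinner (R x) x \<in> \<real>\<^sub>\<ge>\<^sub>0"
    using assms by (auto simp: positive_op_def)
  then have sym: "cinner (R x) x = cinner x (R x)" for x
    by (metis cinner_commute complex_cnj_complex_of_real nonneg_Reals_cases)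
  note add = bounded_op_onD(2)[OF R, simplified] and scale = bounded_op_onD(3)[OF R, simplified]
  \<comment> \<open>Polarization: the form is real at \<open>x + y\<close>, which gives one linear
    relation; replacing \<open>y\<close> by \<open>\<i> *\<^sub>C y\<close> gives a second, and
    together they isolate a single term.\<close>
  have 1: "cinner (R x) y + cinner (R y) x = cinner x (R y) + cinner y (R x)" for x y
    using sym[of "x + y"] sym[of x] sym[of y] by (simp add: add cinner_add_left cinner_add_right add.commute)
  have "cinner (R x) (\<i> *\<^sub>C y) + cinner (R (\<i> *\<^sub>C y)) x = cinner x (R (\<i> *\<^sub>C y)) + cinner (\<i> *\<^sub>C y) (R x)"
    by (rule 1)
  then have "- \<i> * cinner (R x) y + \<i> * cinner (R y) x = - \<i> * cinner x (R y) + \<i> * cinner y (R x)"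
    by (simp add: scale cinner_scaleC_left cinner_scaleC_right)
  then have "\<i> * (cinner (R y) x - cinner (R x) y) = \<i> * (cinner y (R x) - cinner x (R y))"
    by (simp add: algebra_simps)
  then have "cinner (R y) x - cinner (R x) y = cinner y (R x) - cinner x (R y)"
    by simp
  with 1[of x y] have "2 * cinner (R x) y = 2 * cinner x (R y)"
    by algebra
  then show ?thesis
    by simp
qed

text \<open>Moving from \<open>y\<close> in the direction \<open>- R y\<close> changes the quadratic
  form to first order by \<open>- 2 * (norm (R y))^2\<close>. The form vanishes at \<open>y\<close>
  and is never negative, so this must be 0.\<close>

lemma positive_op_eq_0:
  assumes R: "positive_op R" and zero: "cinner (R y) y = 0"
  shows "R y = 0"
proof -
  have lin: "bounded_linear R"
    using R by (simp add: positive_op_def bounded_op_bounded_linear)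
  interpret R: bounded_linear R by fact
  define a where "a = (norm (R y))\<^sup>2"
  define b where "b = Re (cinner (R (R y)) (R y))"
  have nonneg: "0 \<le> Re (cinner (R x) x)" for x
    using R by (simp add: positive_op_def complex_nonneg_Reals_iff)
  have quadratic: "0 \<le> - 2 * t * a + t\<^sup>2 * b" for t
  proof -
    have "cinner (R (R y)) y = cinner (R y) (R y)"
      using R by (rule positive_op_selfadjoint)
    then have "Re (cinner (R (y - t *\<^sub>R R y)) (y - t *\<^sub>R R y)) = - 2 * t * a + t\<^sup>2 * b"
      using zero unfolding a_def b_def
      by (simp add: R.diff R.scaleR cinner_diff_left cinner_diff_right cinner_scaleR_left
          cinner_scaleR_right cinner_self power2_eq_square algebra_simps)
    with nonneg show ?thesis
      by metis
  qed
  define s where "s = 1 + b"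
  have s: "s > 0" "b = s - 1"
    using nonneg[of "R y"] by (simp_all add: s_def b_def)
  have "0 \<le> - 2 * (a / s) * a + (a / s)\<^sup>2 * (s - 1)"
    using quadratic[of "a / s"] by (simp add: s(2))
  also have "\<dots> = - (a\<^sup>2) * (s + 1) / s\<^sup>2"
    using s(1) by (simp add: field_simps power2_eq_square)
  finally have "a\<^sup>2 * (s + 1) \<le> 0"
    using s(1) by (simp add: divide_le_0_iff zero_le_divide_iff)
  then have "a = 0"
    using s(1) by (simp add: mult_le_0_iff)
  then show ?thesis
    by (simp add: a_def)
qed

context
  fixes C :: "'a::chilbert_space \<Rightarrow> 'a"
  assumes C: "contraction_op C" and self: "\<And>x y. cinner (C x) y = cinner x (C y)"
begin

lemma positive_op_diff_sqrt_limit: "positive_op (\<lambda>x. x - sqrt_limit C x)"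
  unfolding positive_op_def bounded_op_on_def
proof (intro conjI ballI allI)
  have "norm (x - sqrt_limit C x) \<le> 2 * norm x" for x
    using norm_triangle_ineq4[of x "sqrt_limit C x"] norm_sqrt_limit[OF C, of x] by simp
  then show "\<exists>K. \<forall>x\<in>UNIV. norm (x - sqrt_limit C x) \<le> K * norm x"
    by blast
  fix x
  have "cnj (cinner (sqrt_limit C x) x) = cinner (sqrt_limit C x) x"
    by (metis C self cinner_commute cinner_sqrt_limit)
  then have "Im (cinner (sqrt_limit C x) x) = 0"
    by (metis Reals_cnj_iff complex_is_Real_iff)
  moreover have "Re (cinner (sqrt_limit C x) x) \<le> norm (sqrt_limit C x) * norm x"
    by (meson complex_Re_le_cmod norm_cinner_le order_trans)
  then have "Re (cinner (sqrt_limit C x) x) \<le> (norm x)\<^sup>2"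
    by (metis C norm_sqrt_limit mult_right_mono norm_ge_zero order_trans power2_eq_square)
  ultimately show "cinner (x - sqrt_limit C x) x \<in> \<real>\<^sub>\<ge>\<^sub>0"
    by (simp add: cinner_diff_left cinner_self complex_nonneg_Reals_iff)
qed (simp_all add: sqrt_limit_add[OF C] sqrt_limit_scaleC[OF C] cvs.scale_right_diff_distrib)

lemma diff_sqrt_limit_square:
  "(\<lambda>x. x - sqrt_limit C x) \<circ> (\<lambda>x. x - sqrt_limit C x) = (\<lambda>x. x - C x)"
proof
  fix x
  have "sqrt_limit C (x - sqrt_limit C x) = sqrt_limit C x - sqrt_limit C (sqrt_limit C x)"
    using sqrt_limit_add[OF C, of "x - sqrt_limit C x" "sqrt_limit C x"]
    by (simp add: eq_diff_eq)
  moreover have "2 *\<^sub>R sqrt_limit C x = C x + sqrt_limit C (sqrt_limit C x)"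
    by (subst sqrt_limit_fixpoint[OF C]) simp
  then have "C x = sqrt_limit C x + sqrt_limit C x - sqrt_limit C (sqrt_limit C x)"
    by (simp add: scaleR_2)
  ultimately show "((\<lambda>x. x - sqrt_limit C x) \<circ> (\<lambda>x. x - sqrt_limit C x)) x = x - C x"
    by (simp only: comp_apply) (simp only: algebra_simps)
qed

text \<open>The root found by iteration has to be the only one. A competitor \<open>R\<close>
  commutes with \<open>C\<close>, since \<open>R \<circ> R\<close> is the identity minus
  \<open>C\<close>, hence with the limit root \<open>L\<close>. Then \<open>R + L\<close>
  annihilates \<open>y = R x - L x\<close>; positivity separates this into \<open>R y = 0\<close>
  and \<open>L y = 0\<close>, and self-adjointness gives \<open>cinner y y = 0\<close>.\<close>

lemma op_sqrt_eq: "op_sqrt (\<lambda>x. x - C x) = (\<lambda>x. x - sqrt_limit C x)"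
  unfolding op_sqrt_def
proof (rule the_equality, intro conjI positive_op_diff_sqrt_limit diff_sqrt_limit_square, elim conjE)
  fix R
  assume R: "positive_op R" and square: "R \<circ> R = (\<lambda>x. x - C x)"
  define L where "L = (\<lambda>x. x - sqrt_limit C x)"
  have L: "positive_op L"
    unfolding L_def by (rule positive_op_diff_sqrt_limit)
  have linR: "bounded_linear R" and linL: "bounded_linear L"
    using R L by (simp_all add: positive_op_def bounded_op_bounded_linear)
  interpret R: bounded_linear R by fact
  interpret L: bounded_linear L by fact
  have RR: "R (R x) = x - C x" for x
    using fun_cong[OF square, of x] by simp
  have LL: "L (L x) = x - C x" for x
    using fun_cong[OF diff_sqrt_limit_square, of x] by (simp add: L_def)
  have "R (C x) = C (R x)" for x
    using RR[of x] RR[of "R x"] by (simp add: R.diff)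
  then have comm: "R (L x) = L (R x)" for x
    using sqrt_limit_intertwining[OF C C linR] by (simp add: R.diff L_def)
  have "R x = L x" for x
  proof -
    define y where "y = R x - L x"
    have 0: "R y + L y = 0"
      by (simp add: y_def R.diff L.diff comm RR LL)
    then have sum: "cinner (R y) y + cinner (L y) y = 0"
      by (metis cinner_add_left cinner_zero_left)
    have "cinner (R y) y \<in> \<real>\<^sub>\<ge>\<^sub>0" "cinner (L y) y \<in> \<real>\<^sub>\<ge>\<^sub>0"
      using R L by (simp_all add: positive_op_def)
    with sum have "cinner (R y) y = 0"
      by (auto simp: complex_nonneg_Reals_iff complex_eq_iff)
    then have Ry: "R y = 0"
      by (rule positive_op_eq_0[OF R])
    have "cinner y y = cinner x (R y) - cinner x (L y)"
      by (metis y_def cinner_diff_left positive_op_selfadjoint[OF R] positive_op_selfadjoint[OF L])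
    then have "y = 0"
      using 0 Ry by simp
    then show ?thesis
      by (simp add: y_def)
  qed
  then show "R = (\<lambda>x. x - sqrt_limit C x)"
    by (auto simp: L_def)
qed

end

section \<open>Defect operators and defect spaces\<close>

lemma csubspace_closure:
  fixes V :: "'a::chilbert_space set"
  assumes V: "cvs.subspace V"
  shows "cvs.subspace (closure V)"
proof (rule cvs.subspaceI)
  show "0 \<in> closure V"
    by (rule subsetD[OF closure_subset cvs.subspace_0[OF V]])
next
  fix x y
  assume "x \<in> closure V" "y \<in> closure V"
  then obtain v w where v: "\<forall>k. v k \<in> V" "v \<longlonglongrightarrow> x" and w: "\<forall>k. w k \<in> V" "w \<longlonglongrightarrow> y"
    unfolding closure_sequential by (elim exE conjE)
  have "\<forall>k. v k + w k \<in> V"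
    using v(1) w(1) V by (simp add: cvs.subspace_add)
  moreover have "(\<lambda>k. v k + w k) \<longlonglongrightarrow> x + y"
    by (intro tendsto_add v w)
  ultimately show "x + y \<in> closure V"
    unfolding closure_sequential by (intro exI[of _ "\<lambda>k. v k + w k"] conjI)
next
  fix c x
  assume "x \<in> closure V"
  then obtain w where w: "\<forall>k. w k \<in> V" "w \<longlonglongrightarrow> x"
    unfolding closure_sequential by (elim exE conjE)
  have "\<forall>k. c *\<^sub>C w k \<in> V"
    using w(1) V by (simp add: cvs.subspace_scale)
  moreover have "(\<lambda>k. c *\<^sub>C w k) \<longlonglongrightarrow> c *\<^sub>C x"
    by (intro bounded_bilinear.tendsto[OF bounded_bilinear_scaleC] tendsto_const w(2))
  ultimately show "c *\<^sub>C x \<in> closure V"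
    unfolding closure_sequential by (intro exI[of _ "\<lambda>k. c *\<^sub>C w k"] conjI)
qed

lemma csubspace_range:
  assumes "bounded_op R"
  shows "cvs.subspace (range R)"
proof (rule cvs.subspaceI)
  show "0 \<in> range R"
    using bounded_op_onD(2)[OF assms, of 0 0] by (metis UNIV_I add_cancel_left_left rangeI)
  show "x + y \<in> range R" if xy: "x \<in> range R" "y \<in> range R" for x y
  proof -
    obtain a b where "x = R a" "y = R b"
      using xy by (elim rangeE)
    then have "x + y = R (a + b)"
      using bounded_op_onD(2)[OF assms, of a b] by simp
    then show ?thesis
      by (simp only: rangeI)
  qed
  show "c *\<^sub>C x \<in> range R" if x: "x \<in> range R" for c x
  proof -
    obtain a where "x = R a"
      using x by (elim rangeE)
    then have "c *\<^sub>C x = R (c *\<^sub>C a)"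
      using bounded_op_onD(3)[OF assms, of a c] by simp
    then show ?thesis
      by (simp only: rangeI)
  qed
qed

context
  fixes T :: "'a::chilbert_space \<Rightarrow> 'a"
  assumes T: "contraction_op T"
begin

lemma contraction_bounded_op: "bounded_op T"
  using T by (simp add: contraction_op_def)

lemma contraction_op_adj_comp: "contraction_op (\<lambda>x. adj T (T x))"
proof -
  have "norm (adj T (T x)) \<le> norm x" for x
  proof -
    have "norm (adj T (T x)) \<le> norm (T x)"
      using contraction_op_adj[OF T] by (simp add: contraction_op_def)
    also have "\<dots> \<le> norm x"
      using T by (simp add: contraction_op_def)
    finally show ?thesis .
  qed
  moreover have "bounded_op (\<lambda>x. adj T (T x))"
    unfolding bounded_op_on_def
  proof (intro conjI ballI allI exI[of _ 1])
    show "norm (adj T (T x)) \<le> 1 * norm x" for x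
      using calculation by simp
  qed (simp_all add: bounded_op_onD[OF contraction_bounded_op]
      bounded_op_onD[OF bounded_op_adj[OF contraction_bounded_op]])
  ultimately show ?thesis
    by (simp add: contraction_op_def)
qed

lemma cinner_adj_comp: "cinner (adj T (T x)) y = cinner x (adj T (T y))"
  by (simp add: cinner_adj_left cinner_adj_right contraction_bounded_op)

lemma defect_op_eq: "defect_op T = (\<lambda>x. x - sqrt_limit (\<lambda>x. adj T (T x)) x)"
  unfolding defect_op_def by (rule op_sqrt_eq[OF contraction_op_adj_comp cinner_adj_comp])

lemma positive_op_defect: "positive_op (defect_op T)"
  unfolding defect_op_eq by (rule positive_op_diff_sqrt_limit[OF contraction_op_adj_comp cinner_adj_comp])

lemma bounded_op_defect: "bounded_op (defect_op T)"
  using positive_op_defect by (simp add: positive_op_def)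

lemma cinner_defect: "cinner (defect_op T x) y = cinner x (defect_op T y)"
  using positive_op_defect by (rule positive_op_selfadjoint)

lemma defect_defect: "defect_op T (defect_op T x) = x - adj T (T x)"
  using fun_cong[OF diff_sqrt_limit_square[OF contraction_op_adj_comp cinner_adj_comp], of x]
  by (simp add: defect_op_eq)

lemma csubspace_defect_space: "cvs.subspace (defect_space T)"
  unfolding defect_space_def by (intro csubspace_closure csubspace_range bounded_op_defect)

lemma closed_defect_space: "closed (defect_space T)"
  unfolding defect_space_def by (rule closed_closure)

lemma defect_in_defect_space: "defect_op T x \<in> defect_space T"
  unfolding defect_space_def by (rule subsetD[OF closure_subset rangeI])

end

text \<open>\<open>T\<close> intertwines \<open>adj T \<circ> T\<close> with
  \<open>T \<circ> adj T\<close>, hence also the limits that define their defect operators.\<close>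

lemma defect_intertwining:
  assumes T: "contraction_op T"
  shows "T (defect_op T x) = defect_op (adj T) (T x)"
proof -
  have T0: "bounded_op T"
    using T by (rule contraction_bounded_op)
  have lin: "bounded_linear T"
    using T0 by (rule bounded_op_bounded_linear)
  have T': "contraction_op (adj T)"
    using T by (rule contraction_op_adj)
  have "T (sqrt_limit (\<lambda>x. adj T (T x)) x) = sqrt_limit (\<lambda>x. adj (adj T) (adj T x)) (T x)"
    by (rule sqrt_limit_intertwining[OF contraction_op_adj_comp[OF T] contraction_op_adj_comp[OF T'] lin])
      (simp only: adj_adj[OF T0])
  then show ?thesis
    by (simp only: defect_op_eq[OF T] defect_op_eq[OF T'] linear_diff[OF bounded_linear.linear[OF lin]])
qed

section \<open>Finite-dimensional ranges\<close>

definition orthonormal_set :: "'a::chilbert_space set \<Rightarrow> bool" where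
  "orthonormal_set B \<longleftrightarrow> finite B \<and> (\<forall>e\<in>B. \<forall>f\<in>B. cinner e f = (if e = f then 1 else 0))"

lemma cinner_orthonormal_sum:
  assumes "orthonormal_set B" "e \<in> B"
  shows "cinner (\<Sum>f\<in>B. c f *\<^sub>C f) e = c e"
proof -
  have "cinner (\<Sum>f\<in>B. c f *\<^sub>C f) e = (\<Sum>f\<in>B. if f = e then c f else 0)"
    unfolding cinner_sum_left cinner_scaleC_left
    using assms by (intro sum.cong) (auto simp: orthonormal_set_def)
  also have "\<dots> = c e"
    using assms by (simp add: orthonormal_set_def)
  finally show ?thesis .
qed

text \<open>Gram-Schmidt, one vector at a time; a vector equal to its projection \<open>p\<close> is
  dropped.\<close>

lemma orthonormal_set_span:
  assumes "finite B"
  shows "\<exists>Q. orthonormal_set Q \<and> cvs.span Q = cvs.span (B :: 'a::chilbert_space set)"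
  using assms
proof (induction B rule: finite_induct)
  case empty
  show ?case
    by (intro exI[of _ "{}"]) (simp add: orthonormal_set_def)
next
  case (insert b B)
  then obtain Q where Q: "orthonormal_set Q" "cvs.span Q = cvs.span B"
    by blast
  define p where "p = (\<Sum>f\<in>Q. cinner b f *\<^sub>C f)"
  have p: "p \<in> cvs.span Q"
    unfolding p_def by (intro cvs.span_sum cvs.span_scale cvs.span_base)
  show ?case
  proof (cases "b = p")
    case True
    then have "cvs.span (insert b B) = cvs.span B"
      using p Q(2) by (simp add: cvs.span_redundant)
    then show ?thesis
      using Q by auto
  next
    case False
    define r where "r = complex_of_real (inverse (norm (b - p)))"
    define e where "e = r *\<^sub>C (b - p)"
    have r: "r \<noteq> 0"
      using False by (simp add: r_def)
    have orth: "cinner e f = 0" if "f \<in> Q" for f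
      using cinner_orthonormal_sum[OF Q(1) that, of "cinner b"]
      by (simp add: e_def p_def cinner_scaleC_left cinner_diff_left)
    then have orth': "cinner f e = 0" if "f \<in> Q" for f
      using that cinner_commute[of f e] by simp
    have "norm e = 1"
      using False by (simp add: e_def r_def norm_scaleC norm_inverse)
    then have "cinner e e = 1"
      by (simp add: cinner_self)
    then have "orthonormal_set (insert e Q)"
      using Q(1) orth orth' by (auto simp: orthonormal_set_def)
    moreover have "cvs.span (insert e Q) = cvs.span (insert b B)"
    proof -
      have sub: "cvs.span Q \<subseteq> cvs.span (insert b B)" "cvs.span Q \<subseteq> cvs.span (insert e Q)"
        by (simp_all add: Q(2) cvs.span_mono subset_insertI) (simp add: cvs.span_mono subset_insertI flip: Q(2))
      have "e \<in> cvs.span (insert b B)"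
        unfolding e_def using subsetD[OF sub(1) p]
        by (intro cvs.span_scale cvs.span_diff) (simp_all add: cvs.span_base)
      moreover have "b = p + inverse r *\<^sub>C e"
        using r by (simp add: e_def scaleC_scaleC scaleC_one)
      then have "b \<in> cvs.span (insert e Q)"
        using cvs.span_add[OF subsetD[OF sub(2) p] cvs.span_scale[OF cvs.span_base[OF insertI1]]]
        by simp
      moreover have "Q \<subseteq> cvs.span (insert b B)" "B \<subseteq> cvs.span (insert e Q)"
        using sub cvs.span_superset[of Q] cvs.span_superset[of B] unfolding Q(2)[symmetric]
        by (meson order_trans)+
      ultimately show ?thesis
        unfolding cvs.span_eq by simp
    qed
    ultimately show ?thesis
      by blast
  qed
qed

text \<open>Stated for subspaces of \<open>E\<close> so that it applies to the range of an operator
  when only the closure of the range is given as finite-dimensional.\<close>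

lemma subspace_orthonormal_basis:
  assumes E: "finite_cdim E" and V: "cvs.subspace V" "V \<subseteq> E"
  obtains Q where "orthonormal_set Q" "cvs.span Q = V"
proof -
  obtain F where F: "finite F" "cvs.span F = E"
    using E unfolding finite_cdim_def by blast
  obtain B where B: "B \<subseteq> V" "cvs.independent B" "V \<subseteq> cvs.span B"
    using cvs.maximal_independent_subset by blast
  have "finite B"
    using cvs.independent_span_bound[OF F(1) B(2)] B(1) V(2) F(2) by blast
  moreover have "cvs.span B = V"
    using B V(1) cvs.span_minimal by blast
  ultimately show ?thesis
    using orthonormal_set_span that by metis
qed

lemma bounded_op_finite_rank:
  fixes Q :: "'a::chilbert_space set"
  shows "bounded_op (\<lambda>x. \<Sum>e\<in>Q. cinner x e *\<^sub>C g e)"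
  unfolding bounded_op_on_def
proof (intro conjI ballI allI)
  have "norm (\<Sum>e\<in>Q. cinner x e *\<^sub>C g e) \<le> (\<Sum>e\<in>Q. norm e * norm (g e)) * norm x" for x
  proof -
    have "norm (\<Sum>e\<in>Q. cinner x e *\<^sub>C g e) \<le> (\<Sum>e\<in>Q. norm (cinner x e *\<^sub>C g e))"
      by (rule norm_sum)
    also have "\<dots> \<le> (\<Sum>e\<in>Q. norm x * norm e * norm (g e))"
      by (intro sum_mono) (simp add: norm_scaleC norm_cinner_le mult_right_mono)
    finally show ?thesis
      by (simp add: sum_distrib_left mult_ac)
  qed
  then show "\<exists>K. \<forall>x\<in>UNIV. norm (\<Sum>e\<in>Q. cinner x e *\<^sub>C g e) \<le> K * norm x"
    by blast
qed (simp_all add: cinner_add_left cinner_scaleC_left scaleC_add_left sum.distrib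
    cvs.scale_sum_right scaleC_scaleC)

lemma bounded_op_comp:
  assumes "bounded_op R" "bounded_op T"
  shows "bounded_op (\<lambda>x. R (T x))"
proof -
  have "bounded_linear (\<lambda>x. R (T x))"
    using assms by (intro bounded_linear_compose[of R T] bounded_op_bounded_linear)
  then obtain K where "\<And>x. norm (R (T x)) \<le> norm x * K"
    using bounded_linear.bounded by blast
  then show ?thesis
    using bounded_op_onD(2,3)[OF assms(1)] bounded_op_onD(2,3)[OF assms(2)]
    unfolding bounded_op_on_def by (auto simp: mult.commute)
qed

lemma bounded_op_diff:
  assumes "bounded_op R" "bounded_op T"
  shows "bounded_op (\<lambda>x. R x - T x)"
proof -
  have "bounded_linear (\<lambda>x. R x - T x)"
    using assms by (intro bounded_linear_sub bounded_op_bounded_linear)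
  then obtain K where "\<And>x. norm (R x - T x) \<le> norm x * K"
    using bounded_linear.bounded by blast
  then show ?thesis
    using bounded_op_onD(2,3)[OF assms(1)] bounded_op_onD(2,3)[OF assms(2)]
    unfolding bounded_op_on_def by (auto simp: mult.commute cvs.scale_right_diff_distrib)
qed

text \<open>\<open>P\<close> is the orthogonal projection onto the range of \<open>R\<close>, and
  \<open>G\<close> is the Moore-Penrose inverse of \<open>R\<close>: \<open>R G = P\<close>, and
  \<open>G (R x) - x\<close> lies in the kernel of \<open>R\<close>. The first kernel condition
  yields \<open>\<Delta> G R = \<Delta>\<close>; the second yields
  \<open>P \<Delta> = \<Delta>\<close>, since the kernel of \<open>R\<close> is the orthogonal
  complement of its range. Hence \<open>Y = G \<Delta> G\<close>.\<close>

lemma finite_rank_factorization: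
  fixes R :: "'a::chilbert_space \<Rightarrow> 'a"
  assumes R: "bounded_op R" "\<And>x y. cinner (R x) y = cinner x (R y)"
    and fin: "finite_cdim (closure (range R))"
    and \<Delta>: "bounded_op \<Delta>" "\<And>x y. cinner (\<Delta> x) y = cinner x (\<Delta>' y)"
    and ker: "\<And>h. R h = 0 \<Longrightarrow> \<Delta> h = 0" "\<And>h. R h = 0 \<Longrightarrow> \<Delta>' h = 0"
  shows "\<exists>Y. bounded_op Y \<and> range Y \<subseteq> range R \<and> (\<forall>x. \<Delta> x = R (Y (R x)))"
proof -
  interpret R: bounded_linear R
    using R(1) by (rule bounded_op_bounded_linear)
  interpret \<Delta>: bounded_linear \<Delta>
    using \<Delta>(1) by (rule bounded_op_bounded_linear)
  obtain Q where Q: "orthonormal_set Q" "cvs.span Q = range R"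
    by (rule subspace_orthonormal_basis[OF fin csubspace_range[OF R(1)] closure_subset])
  have OR: "e \<in> range R" if "e \<in> Q" for e
    unfolding Q(2)[symmetric] using that by (rule cvs.span_base)
  define P where "P x = (\<Sum>e\<in>Q. cinner x e *\<^sub>C e)" for x
  have P_in: "P x \<in> range R" for x
    unfolding P_def Q(2)[symmetric] by (intro cvs.span_sum cvs.span_scale cvs.span_base)
  have orth_ker: "R u = 0" if "\<And>y. y \<in> range R \<Longrightarrow> cinner u y = 0" for u
  proof -
    have "cinner (R u) (R u) = cinner u (R (R u))"
      by (rule R(2))
    also have "\<dots> = 0"
      by (rule that) simp
    finally show ?thesis
      by simp
  qed
  have orth: "cinner (x - P x) y = 0" if "y \<in> range R" for x y
  proof -
    have "cvs.subspace {y. cinner (x - P x) y = 0}"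
      by (rule cvs.subspaceI) (simp_all add: cinner_add_right cinner_scaleC_right)
    moreover have "Q \<subseteq> {y. cinner (x - P x) y = 0}"
      unfolding P_def using cinner_orthonormal_sum[OF Q(1)] by (auto simp: cinner_diff_left)
    ultimately have "cvs.span Q \<subseteq> {y. cinner (x - P x) y = 0}"
      by (intro cvs.span_minimal)
    then have "y \<in> {y. cinner (x - P x) y = 0}"
      unfolding Q(2) using that by (rule subsetD)
    then show ?thesis
      by (rule CollectD)
  qed
  have RP: "R (P x) = R x" for x
    using orth_ker[OF orth, of x] by (simp add: R.diff)
  have P_id: "P y = y" if "y \<in> range R" for y
  proof -
    have "y - P y \<in> range R"
      using csubspace_range[OF R(1)] that P_in by (rule cvs.subspace_diff)
    then have "cinner (y - P y) (y - P y) = 0"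
      by (rule orth)
    then show ?thesis
      by simp
  qed
  \<comment> \<open>Projecting a preimage onto the range of \<open>R\<close> keeps its image under
    \<open>R\<close>. This normalization places the range of \<open>G\<close>, and so that of
    \<open>Y\<close>, inside the range of \<open>R\<close>.\<close>
  have "\<exists>g\<in>range R. R g = e" if e: "e \<in> Q" for e
  proof -
    obtain w where "e = R w"
      using OR[OF e] by (elim rangeE)
    then show ?thesis
      using P_in[of w] RP[of w] by (intro bexI[of _ "P w"]) simp_all
  qed
  then obtain g where g: "\<And>e. e \<in> Q \<Longrightarrow> g e \<in> range R" "\<And>e. e \<in> Q \<Longrightarrow> R (g e) = e"
    by metis
  define G where "G y = (\<Sum>e\<in>Q. cinner y e *\<^sub>C g e)" for y
  have G: "bounded_op G"
    unfolding G_def by (rule bounded_op_finite_rank)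
  have G_in: "G y \<in> range R" for y
    unfolding G_def using g(1)
    by (intro cvs.subspace_sum[OF csubspace_range[OF R(1)]]
        cvs.subspace_scale[OF csubspace_range[OF R(1)]])
  have RG: "R (G y) = P y" for y
    unfolding G_def P_def R.sum using g(2) bounded_op_onD(3)[OF R(1)] by simp
  have "\<Delta> x = R (G (\<Delta> (G (R x))))" for x
  proof -
    have "R (G (R x) - x) = 0"
      by (simp add: R.diff RG P_id)
    then have "\<Delta> (G (R x)) = \<Delta> x"
      using ker(1)[of "G (R x) - x"] by (simp add: \<Delta>.diff)
    \<comment> \<open>The component of \<open>\<Delta> x\<close> orthogonal to the range of
      \<open>R\<close> lies in the kernel of \<open>R\<close>, so
      \<open>cinner (\<Delta> x) u = cinner x (\<Delta>' u) = 0\<close>, and \<open>u\<close> is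
      orthogonal to itself.\<close>
    moreover define u where "u = \<Delta> x - P (\<Delta> x)"
    have "R u = 0"
      unfolding u_def by (rule orth_ker[OF orth])
    then have "cinner (\<Delta> x) u = 0"
      by (simp add: \<Delta>(2) ker(2))
    moreover have "cinner (P (\<Delta> x)) u = 0"
      using orth[OF P_in, of "\<Delta> x" "\<Delta> x"] cinner_commute[of "P (\<Delta> x)" u] by (simp add: u_def)
    ultimately have "cinner u u = 0"
      by (subst (1) u_def) (simp add: cinner_diff_left)
    then have "u = 0"
      by simp
    then have "P (\<Delta> x) = \<Delta> x"
      unfolding u_def right_minus_eq by (rule sym)
    with \<open>\<Delta> (G (R x)) = \<Delta> x\<close> show ?thesis
      by (simp add: RG)
  qed
  moreover have "bounded_op (\<lambda>x. G (\<Delta> (G x)))"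
    by (rule bounded_op_comp[OF G bounded_op_comp[OF \<Delta>(1) G]])
  moreover have "range (\<lambda>x. G (\<Delta> (G x))) \<subseteq> range R"
    by (rule image_subsetI) (rule G_in)
  ultimately show ?thesis
    by (intro exI[of _ "\<lambda>x. G (\<Delta> (G x))"] conjI allI)
qed

section \<open>From the equations over \<open>D\<close> to the equations over
  \<open>Ds\<close>\<close>

lemma bounded_op_on_zero:
  assumes "bounded_op_on E T" "0 \<in> E"
  shows "T 0 = 0"
  using bounded_op_onD(2)[OF assms(1,2,2)] by simp

lemma agler_youngD:
  assumes "agler_young n S"
  shows agler_young_bounded: "k \<in> {1..n} \<Longrightarrow> bounded_op (S k)"
    and agler_young_commute: "k \<in> {1..n} \<Longrightarrow> l \<in> {1..n} \<Longrightarrow> S k (S l x) = S l (S k x)"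
    and agler_young_contraction: "contraction_op (S n)"
    and agler_young_equation: "\<exists>X. \<forall>i\<in>{1..<n}. bounded_op_on (defect_space (S n)) (X i) \<and>
      (\<forall>x. S i x - adj (S (n - i)) (S n x) = defect_op (S n) (X i (defect_op (S n) x)))"
proof -
  note S = assms[unfolded agler_young_def]
  show "bounded_op (S k)" if "k \<in> {1..n}"
    using conjunct1[OF S] that by (rule bspec)
  show "S k (S l x) = S l (S k x)" if "k \<in> {1..n}" "l \<in> {1..n}"
  proof -
    have "S k \<circ> S l = S l \<circ> S k"
      by (rule bspec[OF bspec[OF conjunct1[OF conjunct2[OF S]] that(1)] that(2)])
    then show ?thesis
      by (rule comp_eq_dest)
  qed
qed (use assms in \<open>simp_all only: agler_young_def\<close>)

lemma agler_young_adjoint_factorization: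
  assumes S: "agler_young n S" and i: "i \<in> {1..<n}"
    and fin: "finite_cdim (defect_space (adj (S n)))"
  shows "\<exists>Y. bounded_op Y \<and> range Y \<subseteq> defect_space (adj (S n)) \<and>
    (\<forall>x. S i x - S n (adj (S (n - i)) x) = defect_op (adj (S n)) (Y (defect_op (adj (S n)) x)))"
proof -
  define T where "T = S n"
  define D where "D = defect_op T"
  define Ds where "Ds = defect_op (adj T)"
  have idx: "i \<in> {1..n}" "n - i \<in> {1..n}" "n \<in> {1..n}"
    using i by auto
  have bS: "bounded_op (S i)" "bounded_op (S (n - i))" "bounded_op T"
    unfolding T_def by (intro agler_young_bounded[OF S] idx)+
  have comm: "S i (T x) = T (S i x)" for x
    unfolding T_def by (intro agler_young_commute[OF S] idx)
  have T: "contraction_op T"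
    unfolding T_def by (rule agler_young_contraction[OF S])
  note T' = contraction_op_adj[OF T]
  obtain X where X: "\<forall>k\<in>{1..<n}. bounded_op_on (defect_space T) (X k) \<and>
      (\<forall>x. S k x - adj (S (n - k)) (T x) = D (X k (D x)))"
    using agler_young_equation[OF S] unfolding T_def D_def by (elim exE)
  have D0: "D 0 = 0"
    unfolding D_def by (rule bounded_op_on_zero[OF bounded_op_defect[OF T]]) simp
  \<comment> \<open>If \<open>Ds h = 0\<close>, then \<open>h = T g\<close> for
    \<open>g = adj T h\<close>, and \<open>D (D g) = g - adj T h = 0\<close> gives
    \<open>D g = 0\<close>. At \<open>g\<close> the right-hand sides of the Agler-Young equations
    therefore vanish.\<close>
  have coisometric: "\<exists>g. adj T h = g \<and> T g = h \<and> (\<forall>k\<in>{1..<n}. S k g = adj (S (n - k)) h)"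
    if "Ds h = 0" for h
  proof (intro exI[of _ "adj T h"] conjI refl ballI)
    have "Ds (Ds h) = 0"
      unfolding that unfolding Ds_def
      by (rule bounded_op_on_zero[OF bounded_op_defect[OF T']]) simp
    then show 1: "T (adj T h) = h"
      by (simp add: Ds_def defect_defect[OF T'] adj_adj bS(3))
    have "D (D (adj T h)) = 0"
      by (simp add: D_def defect_defect[OF T] 1)
    then have "cinner (D (adj T h)) (D (adj T h)) = 0"
      unfolding D_def by (simp add: cinner_defect[OF T])
    then have 2: "D (adj T h) = 0"
      by simp
    fix k
    assume k: "k \<in> {1..<n}"
    have "X k 0 = 0"
      using conjunct1[OF bspec[OF X k]] cvs.subspace_0[OF csubspace_defect_space[OF T]] by (rule bounded_op_on_zero)
    then show "S k (adj T h) = adj (S (n - k)) h"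
      using spec[OF conjunct2[OF bspec[OF X k]], of "adj T h"] by (simp add: 1 2 D0)
  qed
  have ni: "n - i \<in> {1..<n}" "n - (n - i) = i"
    using i by auto
  have "\<exists>Y. bounded_op Y \<and> range Y \<subseteq> range Ds \<and>
      (\<forall>x. S i x - T (adj (S (n - i)) x) = Ds (Y (Ds x)))"
  proof (rule finite_rank_factorization)
    show "bounded_op Ds" "cinner (Ds x) y = cinner x (Ds y)" for x y
      unfolding Ds_def by (rule bounded_op_defect[OF T'], rule cinner_defect[OF T'])
    show "finite_cdim (closure (range Ds))"
      using fin by (simp add: Ds_def defect_space_def T_def)
    show "bounded_op (\<lambda>x. S i x - T (adj (S (n - i)) x))"
      by (rule bounded_op_diff[OF bS(1) bounded_op_comp[OF bS(3) bounded_op_adj[OF bS(2)]]])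
    show "cinner (S i x - T (adj (S (n - i)) x)) y = cinner x (adj (S i) y - S (n - i) (adj T y))"
      for x y
    proof -
      have "cinner (T (adj (S (n - i)) x)) y = cinner x (S (n - i) (adj T y))"
        using bS by (metis cinner_adj_left cinner_adj_right)
      then show ?thesis
        using bS by (simp add: cinner_diff_left cinner_diff_right cinner_adj_right)
    qed
    fix h
    assume "Ds h = 0"
    then obtain g where g: "adj T h = g" "T g = h" "\<And>k. k \<in> {1..<n} \<Longrightarrow> S k g = adj (S (n - k)) h"
      using coisometric by blast
    \<comment> \<open>With \<open>k = i\<close>, the subtracted term is \<open>T (S i g)\<close>;
      commuting \<open>S i\<close> past \<open>T\<close> turns it into \<open>S i h\<close>.\<close>
    show "S i h - T (adj (S (n - i)) h) = 0"
      using g(3)[OF i] comm[of g] by (simp add: g(2))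
    \<comment> \<open>The adjoint condition uses the equation at the reflected index
      \<open>k = n - i\<close>.\<close>
    show "adj (S i) h - S (n - i) (adj T h) = 0"
      using g(3)[OF ni(1)] by (simp add: g(1) ni(2))
  qed
  moreover have "range Ds \<subseteq> defect_space (adj (S n))"
    unfolding defect_space_def Ds_def T_def by (rule closure_subset)
  ultimately show ?thesis
    unfolding Ds_def T_def by blast
qed

section \<open>Taylor coefficients\<close>

text \<open>Square-summability is left out: \<open>taylor_coeff\<close> and
  \<open>hardy_inner\<close> see only the expansion on the disc, so a product with
  \<open>char_fun T\<close> can be paired without first being placed in the Hardy space.\<close>

definition has_coeffs :: "(complex \<Rightarrow> 'a::chilbert_space) \<Rightarrow> (nat \<Rightarrow> 'a) \<Rightarrow> bool" where
  "has_coeffs f a \<longleftrightarrow> (\<forall>z\<in>ball 0 1. (\<lambda>k. z ^ k *\<^sub>C a k) sums f z)"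

definition power_series :: "(nat \<Rightarrow> 'a::chilbert_space) \<Rightarrow> complex \<Rightarrow> 'a" where
  "power_series a z = (if z \<in> ball 0 1 then \<Sum>k. z ^ k *\<^sub>C a k else 0)"

lemma hardy_iff:
  "f \<in> hardy E \<longleftrightarrow> (\<exists>a. (\<forall>k. a k \<in> E) \<and> summable (\<lambda>k. (norm (a k))\<^sup>2) \<and> has_coeffs f a \<and>
     (\<forall>z. z \<notin> ball 0 1 \<longrightarrow> f z = 0))"
  by (simp only: hardy_def has_coeffs_def mem_Collect_eq)

lemma has_coeffs_sums: "has_coeffs f a \<Longrightarrow> z \<in> ball 0 1 \<Longrightarrow> (\<lambda>k. z ^ k *\<^sub>C a k) sums f z"
  unfolding has_coeffs_def by (rule bspec)

lemmas bounded_linear_scaleC_right = bounded_bilinear.bounded_linear_right[OF bounded_bilinear_scaleC]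
lemmas bounded_linear_cinner_left = bounded_bilinear.bounded_linear_left[OF bounded_bilinear_cinner]

lemma has_coeffs_power_series:
  assumes "\<And>k. norm (a k) \<le> K"
  shows "has_coeffs (power_series a) a"
  unfolding has_coeffs_def
proof
  fix z :: complex
  assume z: "z \<in> ball 0 1"
  have "summable (\<lambda>k. z ^ k *\<^sub>C a k)"
  proof (rule summable_comparison_test')
    show "summable (\<lambda>k. K * norm z ^ k)"
      using z by (intro summable_mult summable_geometric) simp
    show "norm (z ^ k *\<^sub>C a k) \<le> K * norm z ^ k" if "0 \<le> k" for k
      using mult_left_mono[OF assms[of k], of "norm z ^ k"]
      by (simp add: norm_scaleC norm_power mult.commute)
  qed
  then show "(\<lambda>k. z ^ k *\<^sub>C a k) sums power_series a z"
    using z by (simp add: power_series_def summable_sums)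
qed

lemma has_coeffs_diff:
  assumes "has_coeffs f a" "has_coeffs g b"
  shows "has_coeffs (\<lambda>z. f z - g z) (\<lambda>k. a k - b k)"
  using assms unfolding has_coeffs_def by (simp add: cvs.scale_right_diff_distrib sums_diff)

lemma has_coeffs_add:
  assumes "has_coeffs f a" "has_coeffs g b"
  shows "has_coeffs (\<lambda>z. f z + g z) (\<lambda>k. a k + b k)"
  using assms unfolding has_coeffs_def by (simp add: scaleC_add_right sums_add)

lemma has_coeffs_scaleC:
  assumes "has_coeffs f a"
  shows "has_coeffs (\<lambda>z. c *\<^sub>C f z) (\<lambda>k. c *\<^sub>C a k)"
  unfolding has_coeffs_def
proof
  fix z :: complex
  assume "z \<in> ball 0 1"
  then have "(\<lambda>k. c *\<^sub>C (z ^ k *\<^sub>C a k)) sums (c *\<^sub>C f z)"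
    by (intro bounded_linear.sums[OF bounded_linear_scaleC_right] has_coeffs_sums[OF assms])
  then show "(\<lambda>k. z ^ k *\<^sub>C (c *\<^sub>C a k)) sums (c *\<^sub>C f z)"
    by (simp add: scaleC_scaleC mult.commute)
qed

lemma has_coeffs_shift:
  assumes "has_coeffs f a"
  shows "has_coeffs (\<lambda>z. z *\<^sub>C f z) (\<lambda>k. case k of 0 \<Rightarrow> 0 | Suc j \<Rightarrow> a j)"
  unfolding has_coeffs_def
proof
  fix z :: complex
  assume "z \<in> ball 0 1"
  then have "(\<lambda>k. z *\<^sub>C (z ^ k *\<^sub>C a k)) sums (z *\<^sub>C f z)"
    by (intro bounded_linear.sums[OF bounded_linear_scaleC_right] has_coeffs_sums[OF assms])
  then have "(\<lambda>k. z ^ Suc k *\<^sub>C (case Suc k of 0 \<Rightarrow> 0 | Suc j \<Rightarrow> a j)) sums (z *\<^sub>C f z)"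
    by (simp add: scaleC_scaleC)
  then show "(\<lambda>k. z ^ k *\<^sub>C (case k of 0 \<Rightarrow> 0 | Suc j \<Rightarrow> a j)) sums (z *\<^sub>C f z)"
    by (subst (asm) sums_Suc_iff) simp
qed

text \<open>\<open>L\<close> is controlled only on \<open>E\<close>, so it is moved through the
  partial sums, and closedness of \<open>E\<close> puts the limit \<open>f z\<close> into its
  domain.\<close>

lemma has_coeffs_apply:
  assumes E: "cvs.subspace E" "closed E" and L: "bounded_op_on E L"
    and a: "\<And>k. a k \<in> E" and f: "has_coeffs f a" and g: "\<And>z. z \<in> ball 0 1 \<Longrightarrow> g z = L (f z)"
  shows "has_coeffs g (\<lambda>k. L (a k))"
  unfolding has_coeffs_def
proof
  fix z :: complex
  assume z: "z \<in> ball 0 1"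
  obtain K where K: "0 \<le> K" "\<And>x. x \<in> E \<Longrightarrow> norm (L x) \<le> K * norm x"
    using bounded_op_on_bound[OF L] by metis
  let ?s = "\<lambda>m. \<Sum>k<m. z ^ k *\<^sub>C a k"
  have s: "?s \<longlonglongrightarrow> f z"
    using has_coeffs_sums[OF f z] unfolding sums_def .
  have sE: "?s m \<in> E" for m
    using a by (intro cvs.subspace_sum cvs.subspace_scale E(1))
  have fE: "f z \<in> E"
    by (rule closed_sequentially[OF E(2) sE s])
  have Ls: "L (?s m) = (\<Sum>k<m. z ^ k *\<^sub>C L (a k))" for m
  proof (induction m)
    case 0
    then show ?case
      by (simp add: bounded_op_on_zero[OF L] cvs.subspace_0[OF E(1)])
  next
    case (Suc m)
    have "z ^ m *\<^sub>C a m \<in> E"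
      using a E(1) by (simp add: cvs.subspace_scale)
    then have "L (?s m + z ^ m *\<^sub>C a m) = L (?s m) + z ^ m *\<^sub>C L (a m)"
      by (simp only: bounded_op_onD(2)[OF L sE] bounded_op_onD(3)[OF L a])
    then show ?case
      using Suc by simp
  qed
  have "(\<lambda>m. L (?s m) - L (f z)) \<longlonglongrightarrow> 0"
  proof (rule Lim_null_comparison)
    have "norm (L (?s m) - L (f z)) \<le> K * norm (?s m - f z)" for m
    proof -
      have d: "?s m - f z \<in> E"
        by (rule cvs.subspace_diff[OF E(1) sE fE])
      have "L (?s m) = L (?s m - f z) + L (f z)"
        using bounded_op_onD(2)[OF L d fE] by simp
      then show ?thesis
        using K(2)[OF d] by simp
    qed
    then show "\<forall>\<^sub>F m in sequentially. norm (L (?s m) - L (f z)) \<le> K * norm (?s m - f z)"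
      by simp
    show "(\<lambda>m. K * norm (?s m - f z)) \<longlonglongrightarrow> 0"
      by (intro tendsto_mult_right_zero tendsto_norm_zero LIM_zero s)
  qed
  then have "(\<lambda>m. L (?s m)) \<longlonglongrightarrow> L (f z)"
    by (rule LIM_zero_cancel)
  then show "(\<lambda>k. z ^ k *\<^sub>C L (a k)) sums g z"
    unfolding sums_def Ls g[OF z] .
qed

text \<open>Pairing with a fixed vector reduces the claim to scalar power series, where vanishing
  near 0 forces all coefficients to vanish.\<close>

lemma has_coeffs_zero:
  assumes c: "has_coeffs (\<lambda>z. 0) c"
  shows "c k = 0"
proof -
  have "cinner (c k) y = 0" for y
  proof -
    define F where "F = Abs_fps (\<lambda>k. cinner (c k) y)"
    have sums: "(\<lambda>k. fps_nth F k * z ^ k) sums 0" if "z \<in> ball 0 1" for z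
    proof -
      have "(\<lambda>k. z ^ k *\<^sub>C c k) sums 0"
        using c that by (simp add: has_coeffs_def)
      from bounded_linear.sums[OF bounded_linear_cinner_left[of y] this]
      show ?thesis
        by (simp add: F_def cinner_scaleC_left mult.commute)
    qed
    have "F = 0"
    proof (rule eval_fps_eqD)
      have "ereal (norm (1/2 :: complex)) \<le> conv_radius (fps_nth F)"
        by (rule conv_radius_geI) (rule sums_summable[OF sums], simp)
      then show "0 < fps_conv_radius F"
        by (simp add: fps_conv_radius_def less_le_trans[of 0 "ereal (1/2)"])
      show "0 < fps_conv_radius (0 :: complex fps)"
        by simp
      have "\<forall>\<^sub>F z in nhds 0. z \<in> ball (0 :: complex) 1"
        by (rule eventually_nhds_in_open) simp_all
      then show "\<forall>\<^sub>F z in nhds 0. eval_fps F z = eval_fps 0 z"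
        by (rule eventually_mono) (simp add: eval_fps_def sums_unique[OF sums, symmetric])
    qed
    then show ?thesis
      by (metis F_def fps_nth_Abs_fps fps_zero_nth)
  qed
  then show ?thesis
    by (metis cinner_self_eq_0)
qed

lemma has_coeffs_unique:
  assumes "has_coeffs f a" "has_coeffs f b"
  shows "a = b"
proof
  fix k
  have "has_coeffs (\<lambda>z. 0) (\<lambda>k. a k - b k)"
    using has_coeffs_diff[OF assms] by simp
  from has_coeffs_zero[OF this, of k] show "a k = b k"
    by simp
qed

lemma taylor_coeff_eq: "has_coeffs f a \<Longrightarrow> taylor_coeff f = a"
  unfolding taylor_coeff_def has_coeffs_def[symmetric]
  by (intro the_equality) (simp_all add: has_coeffs_unique)

lemma hardy_inner_eqI:
  assumes "has_coeffs f a" "has_coeffs g b" "(\<lambda>k. cinner (a k) (b k)) sums s"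
  shows "hardy_inner f g = s"
  using assms(3) by (simp add: hardy_inner_def taylor_coeff_eq[OF assms(1)]
      taylor_coeff_eq[OF assms(2)] sums_unique[symmetric])

lemma has_coeffs_ext:
  assumes "has_coeffs f a" "has_coeffs g a"
    and "\<And>z. z \<notin> ball 0 1 \<Longrightarrow> f z = 0" "\<And>z. z \<notin> ball 0 1 \<Longrightarrow> g z = 0"
  shows "f = g"
proof
  fix z
  show "f z = g z"
  proof (cases "z \<in> ball 0 1")
    case True
    then show ?thesis
      by (intro sums_unique2[OF has_coeffs_sums[OF assms(1)] has_coeffs_sums[OF assms(2)]])
  qed (simp add: assms(3,4))
qed

lemma has_coeffs_cong:
  assumes "has_coeffs f a" "\<And>z. z \<in> ball 0 1 \<Longrightarrow> f z = g z"
  shows "has_coeffs g a"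
  using assms by (simp add: has_coeffs_def)

lemma power_series_outside: "z \<notin> ball 0 1 \<Longrightarrow> power_series a z = 0"
  by (simp add: power_series_def)

lemma summable_cinner:
  assumes a: "summable (\<lambda>k. (norm (a k))\<^sup>2)" and b: "summable (\<lambda>k. (norm (b k))\<^sup>2)"
  shows "summable (\<lambda>k. cinner (a k) (b k))"
    and "cmod (\<Sum>k. cinner (a k) (b k)) \<le> sqrt (\<Sum>k. (norm (a k))\<^sup>2) * sqrt (\<Sum>k. (norm (b k))\<^sup>2)"
proof -
  let ?K = "sqrt (\<Sum>k. (norm (a k))\<^sup>2) * sqrt (\<Sum>k. (norm (b k))\<^sup>2)"
  have le: "(\<Sum>k<m. cmod (cinner (a k) (b k))) \<le> ?K" for m
  proof -
    have "(\<Sum>k<m. cmod (cinner (a k) (b k))) \<le> (\<Sum>k<m. \<bar>norm (a k)\<bar> * \<bar>norm (b k)\<bar>)"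
      by (intro sum_mono) (simp add: norm_cinner_le)
    also have "\<dots> \<le> L2_set (\<lambda>k. norm (a k)) {..<m} * L2_set (\<lambda>k. norm (b k)) {..<m}"
      by (rule L2_set_mult_ineq)
    also have "\<dots> \<le> ?K"
      unfolding L2_set_def
      by (intro mult_mono real_sqrt_le_mono sum_le_suminf a b real_sqrt_ge_zero suminf_nonneg sum_nonneg)
        simp_all
    finally show ?thesis .
  qed
  have s: "summable (\<lambda>k. cmod (cinner (a k) (b k)))"
  proof (rule bounded_imp_summable)
    show "(\<Sum>k\<le>m. cmod (cinner (a k) (b k))) \<le> ?K" for m
      unfolding lessThan_Suc_atMost[symmetric] by (rule le)
  qed simp
  then show "summable (\<lambda>k. cinner (a k) (b k))"
    by (rule summable_norm_cancel)
  have "cmod (\<Sum>k. cinner (a k) (b k)) \<le> (\<Sum>k. cmod (cinner (a k) (b k)))"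
    by (rule summable_norm[OF s])
  also have "\<dots> \<le> ?K"
    using s le by (rule suminf_le_const)
  finally show "cmod (\<Sum>k. cinner (a k) (b k)) \<le> ?K" .
qed

section \<open>The functional model of a pure contraction\<close>

locale pure_contraction =
  fixes T :: "'a::chilbert_space \<Rightarrow> 'a"
  assumes contraction: "contraction_op T"
    and pure: "\<And>x. (\<lambda>m. (adj T ^^ m) x) \<longlonglongrightarrow> 0"
begin

abbreviation A :: "'a \<Rightarrow> 'a" where "A \<equiv> adj T"
abbreviation D :: "'a \<Rightarrow> 'a" where "D \<equiv> defect_op T"
abbreviation Ds :: "'a \<Rightarrow> 'a" where "Ds \<equiv> defect_op (adj T)"

lemma contraction_adj: "contraction_op A"
  by (rule contraction_op_adj[OF contraction])

lemma bounded: "bounded_op T" "bounded_op A" "bounded_op D" "bounded_op Ds"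
  by (rule contraction_bounded_op[OF contraction] contraction_bounded_op[OF contraction_adj]
      bounded_op_defect[OF contraction] bounded_op_defect[OF contraction_adj])+

sublocale T: bounded_linear T
  by (rule bounded_op_bounded_linear[OF bounded(1)])

sublocale A: bounded_linear A
  by (rule bounded_op_bounded_linear[OF bounded(2)])

sublocale D: bounded_linear D
  by (rule bounded_op_bounded_linear[OF bounded(3)])

sublocale Ds: bounded_linear Ds
  by (rule bounded_op_bounded_linear[OF bounded(4)])

lemma op_scaleC:
  "T (c *\<^sub>C x) = c *\<^sub>C T x" "A (c *\<^sub>C x) = c *\<^sub>C A x" "D (c *\<^sub>C x) = c *\<^sub>C D x"
  "Ds (c *\<^sub>C x) = c *\<^sub>C Ds x"
  using bounded_op_onD(3)[OF bounded(1) UNIV_I] bounded_op_onD(3)[OF bounded(2) UNIV_I]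
    bounded_op_onD(3)[OF bounded(3) UNIV_I] bounded_op_onD(3)[OF bounded(4) UNIV_I] by simp_all

lemma cinner_A: "cinner (A x) y = cinner x (T y)"
  by (rule cinner_adj_left[OF bounded(1)])

lemma cinner_T: "cinner (T x) y = cinner x (A y)"
  by (rule cinner_adj_right[OF bounded(1), symmetric])

lemma cinner_D: "cinner (D x) y = cinner x (D y)"
  by (rule cinner_defect[OF contraction])

lemma cinner_Ds: "cinner (Ds x) y = cinner x (Ds y)"
  by (rule cinner_defect[OF contraction_adj])

lemma D_D: "D (D x) = x - A (T x)"
  by (rule defect_defect[OF contraction])

lemma Ds_Ds: "Ds (Ds x) = x - T (A x)"
  using defect_defect[OF contraction_adj, of x] by (simp only: adj_adj[OF bounded(1)])

lemma T_D: "T (D x) = Ds (T x)"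
  by (rule defect_intertwining[OF contraction])

lemma A_Ds: "A (Ds x) = D (A x)"
  using defect_intertwining[OF contraction_adj, of x] by (simp only: adj_adj[OF bounded(1)])

lemma cinner_Ds_Ds: "cinner (Ds x) (Ds y) = cinner x y - cinner (A x) (A y)"
  by (simp only: cinner_Ds Ds_Ds cinner_diff_right cinner_A)

text \<open>By \<open>A_Ds\<close> the range of \<open>Ds\<close> is sent into the range of
  \<open>D\<close>, and continuity extends this to closures. It makes certain differences admissible
  as test vectors in \<open>model_space_subset\<close>.\<close>

lemma A_defect_space:
  assumes "x \<in> defect_space (adj T)"
  shows "A x \<in> defect_space T"
proof -
  have "closure (range Ds) \<subseteq> A -` defect_space T"
  proof (rule closure_minimal)
    show "range Ds \<subseteq> A -` defect_space T"
      using defect_in_defect_space[OF contraction] by (intro image_subsetI vimageI2) (simp only: A_Ds)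
    show "closed (A -` defect_space T)"
      by (intro continuous_closed_vimage closed_defect_space[OF contraction] A.continuous_on
          linear_continuous_at A.bounded_linear_axioms)
  qed
  then show ?thesis
    using assms unfolding defect_space_def by (rule vimageD[OF subsetD])
qed

definition coeff :: "'a \<Rightarrow> nat \<Rightarrow> 'a" where
  "coeff h k = Ds ((A ^^ k) h)"

definition to_model :: "'a \<Rightarrow> complex \<Rightarrow> 'a" where
  "to_model h = power_series (coeff h)"

lemma coeff_Suc: "coeff h (Suc k) = coeff (A h) k"
  by (simp add: coeff_def funpow_swap1)

lemma A_power_add: "(A ^^ k) (x + y) = (A ^^ k) x + (A ^^ k) y"
  by (induction k) (simp_all add: A.add)

lemma A_power_scaleC: "(A ^^ k) (c *\<^sub>C x) = c *\<^sub>C (A ^^ k) x"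
  by (induction k) (simp_all add: op_scaleC)

lemma coeff_add: "coeff (x + y) k = coeff x k + coeff y k"
  by (simp add: coeff_def A_power_add Ds.add)

lemma coeff_scaleC: "coeff (c *\<^sub>C x) k = c *\<^sub>C coeff x k"
  by (simp add: coeff_def A_power_scaleC op_scaleC)

lemma coeff_in: "coeff h k \<in> defect_space (adj T)"
  unfolding coeff_def by (rule defect_in_defect_space[OF contraction_adj])

text \<open>By \<open>cinner_Ds_Ds\<close> each term is the difference of
  \<open>cinner ((A ^^ k) x) ((A ^^ k) y)\<close> at successive \<open>k\<close>; purity makes the
  last boundary term disappear.\<close>

lemma cinner_coeff_sums: "(\<lambda>k. cinner (coeff x k) (coeff y k)) sums cinner x y"
proof -
  have "(\<lambda>k. cinner ((A ^^ k) x) ((A ^^ k) y)) \<longlonglongrightarrow> cinner (0::'a) (0::'a)"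
    by (rule tendsto_cinner[OF pure pure])
  from telescope_sums'[OF this] show ?thesis
    by (simp add: coeff_def cinner_Ds_Ds)
qed

lemma norm_coeff_sums: "(\<lambda>k. (norm (coeff x k))\<^sup>2) sums (norm x)\<^sup>2"
  using bounded_linear.sums[OF bounded_linear_Re cinner_coeff_sums[of x x]] by (simp add: cinner_self)

lemma summable_norm_coeff: "summable (\<lambda>k. (norm (coeff x k))\<^sup>2)"
  by (rule sums_summable[OF norm_coeff_sums])

lemma has_coeffs_to_model: "has_coeffs (to_model h) (coeff h)"
  unfolding to_model_def
proof (rule has_coeffs_power_series)
  fix k
  have "(\<Sum>j\<in>{k}. (norm (coeff h j))\<^sup>2) \<le> (\<Sum>j. (norm (coeff h j))\<^sup>2)"
    by (rule sum_le_suminf[OF summable_norm_coeff]) simp_all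
  then have "(norm (coeff h k))\<^sup>2 \<le> (norm h)\<^sup>2"
    by (simp add: sums_unique[OF norm_coeff_sums, symmetric])
  then show "norm (coeff h k) \<le> norm h"
    by (rule power2_le_imp_le) simp
qed

lemma to_model_outside: "z \<notin> ball 0 1 \<Longrightarrow> to_model h z = 0"
  unfolding to_model_def by (rule power_series_outside)

lemma to_model_in_hardy: "to_model h \<in> hardy (defect_space (adj T))"
  unfolding hardy_iff
  by (intro exI[of _ "coeff h"] conjI allI impI coeff_in summable_norm_coeff has_coeffs_to_model
      to_model_outside)

lemma hardy_inner_to_model: "hardy_inner (to_model x) (to_model y) = cinner x y"
  by (rule hardy_inner_eqI[OF has_coeffs_to_model has_coeffs_to_model cinner_coeff_sums])

lemma to_model_add: "to_model (x + y) = (\<lambda>z. to_model x z + to_model y z)"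
proof (rule has_coeffs_ext[OF has_coeffs_to_model])
  show "has_coeffs (\<lambda>z. to_model x z + to_model y z) (coeff (x + y))"
    unfolding coeff_add[abs_def] by (intro has_coeffs_add has_coeffs_to_model)
qed (simp_all add: to_model_outside del: mem_ball)

lemma to_model_scaleC: "to_model (c *\<^sub>C x) = (\<lambda>z. c *\<^sub>C to_model x z)"
proof (rule has_coeffs_ext[OF has_coeffs_to_model])
  show "has_coeffs (\<lambda>z. c *\<^sub>C to_model x z) (coeff (c *\<^sub>C x))"
    unfolding coeff_scaleC[abs_def] by (intro has_coeffs_scaleC has_coeffs_to_model)
qed (simp_all add: to_model_outside del: mem_ball)

lemma inj_to_model: "inj to_model"
proof (rule injI)
  fix x y
  assume eq: "to_model x = to_model y"
  show "x = y"
    by (rule cinner_eqI) (simp only: hardy_inner_to_model[symmetric] eq)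
qed

text \<open>
  The characteristic function is the transfer function of the unitary colligation with blocks
  \<open>A\<close>, \<open>D\<close>, \<open>Ds\<close>, \<open>- T\<close>; \<open>state b\<close> is the sequence of states produced by the input \<open>b\<close>.
\<close>

primrec state :: "(nat \<Rightarrow> 'a) \<Rightarrow> nat \<Rightarrow> 'a" where
  "state b 0 = 0"
| "state b (Suc k) = A (state b k) + D (b k)"

definition char_output :: "(nat \<Rightarrow> 'a) \<Rightarrow> nat \<Rightarrow> 'a" where
  "char_output b k = Ds (state b k) - T (b k)"

text \<open>The defect identities give the diagonal terms; the cross terms cancel by
  \<open>T_D\<close> and \<open>A_Ds\<close>. The polarized form is needed to compare a free orbit
  with a driven one in \<open>cinner_coeff_output_sums\<close>.\<close>

lemma colligation_unitary:
  "cinner (A x + D b) (A u + D c) + cinner (Ds x - T b) (Ds u - T c) = cinner x u + cinner b c"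
proof -
  have "cinner (A x) (A u) + cinner (Ds x) (Ds u) = cinner x u"
    by (simp add: cinner_Ds_Ds)
  moreover have "cinner (D b) (D c) + cinner (T b) (T c) = cinner b c"
    by (simp add: cinner_D D_D cinner_T cinner_diff_right)
  moreover have "cinner (A x) (D c) = cinner (Ds x) (T c)"
    by (simp add: cinner_A T_D cinner_Ds)
  moreover have "cinner (D b) (A u) = cinner (T b) (Ds u)"
    by (simp add: cinner_T A_Ds cinner_D)
  moreover have "cinner (A x + D b) (A u + D c) + cinner (Ds x - T b) (Ds u - T c) =
      (cinner (A x) (A u) + cinner (Ds x) (Ds u)) + (cinner (D b) (D c) + cinner (T b) (T c)) +
      (cinner (A x) (D c) - cinner (Ds x) (T c)) + (cinner (D b) (A u) - cinner (T b) (Ds u))"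
    by (simp only: cinner_add_left cinner_add_right cinner_diff_left cinner_diff_right) algebra
  ultimately show ?thesis
    by simp
qed

text \<open>Energy balance: state plus output energy after a step equals state plus input energy
  before it, and the initial state is 0.\<close>

lemma norm_state_le:
  assumes b: "summable (\<lambda>k. (norm (b k))\<^sup>2)"
  shows "norm (state b m) \<le> sqrt (\<Sum>k. (norm (b k))\<^sup>2)"
proof -
  have step: "(norm (state b (Suc k)))\<^sup>2 \<le> (norm (state b k))\<^sup>2 + (norm (b k))\<^sup>2" for k
  proof -
    have "(norm (state b (Suc k)))\<^sup>2 + (norm (char_output b k))\<^sup>2 = (norm (state b k))\<^sup>2 + (norm (b k))\<^sup>2"
      using arg_cong[OF colligation_unitary[of "state b k" "b k" "state b k" "b k"], of Re]
      by (simp add: cinner_self char_output_def)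
    then show ?thesis
      by (metis le_add_same_cancel1 zero_le_power2)
  qed
  have "(norm (state b m))\<^sup>2 \<le> (\<Sum>k<m. (norm (b k))\<^sup>2)"
  proof (induction m)
    case (Suc m)
    then show ?case
      using step[of m] by simp
  qed simp
  also have "\<dots> \<le> (\<Sum>k. (norm (b k))\<^sup>2)"
    by (rule sum_le_suminf[OF b]) simp_all
  finally show ?thesis
    by (rule real_le_rsqrt)
qed

text \<open>The generating function \<open>w\<close> of the states satisfies
  \<open>w z = z *\<^sub>C (A (w z) + D (g z))\<close>, so it is the resolvent term of
  \<open>char_fun\<close> applied to \<open>g z\<close>.\<close>

lemma has_coeffs_char_fun:
  assumes g: "has_coeffs g b" and b: "summable (\<lambda>k. (norm (b k))\<^sup>2)"
  shows "has_coeffs (mult_op (char_fun T) g) (char_output b)"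
proof -
  define w where "w = power_series (state b)"
  have w: "has_coeffs w (state b)"
    unfolding w_def by (rule has_coeffs_power_series) (rule norm_state_le[OF b])
  have Aw: "has_coeffs (\<lambda>z. A (w z)) (\<lambda>k. A (state b k))"
    by (rule has_coeffs_apply[OF _ _ bounded(2) _ w]) simp_all
  have Dg: "has_coeffs (\<lambda>z. D (g z)) (\<lambda>k. D (b k))"
    by (rule has_coeffs_apply[OF _ _ bounded(3) _ g]) simp_all
  have Dsw: "has_coeffs (\<lambda>z. Ds (w z)) (\<lambda>k. Ds (state b k))"
    by (rule has_coeffs_apply[OF _ _ bounded(4) _ w]) simp_all
  have Tg: "has_coeffs (\<lambda>z. T (g z)) (\<lambda>k. T (b k))"
    by (rule has_coeffs_apply[OF _ _ bounded(1) _ g]) simp_all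
  have "(\<lambda>k. case k of 0 \<Rightarrow> 0 | Suc j \<Rightarrow> A (state b j) + D (b j)) = state b"
    by (auto split: nat.split)
  then have "has_coeffs (\<lambda>z. z *\<^sub>C (A (w z) + D (g z))) (state b)"
    using has_coeffs_shift[OF has_coeffs_add[OF Aw Dg]] by simp
  then have w_eq: "w z = z *\<^sub>C (A (w z) + D (g z))" if "z \<in> ball 0 1" for z
    by (rule sums_unique2[OF has_coeffs_sums[OF w that] has_coeffs_sums[OF _ that]])
  have resolvent: "z *\<^sub>C inv (\<lambda>y. y - z *\<^sub>C A y) (D (g z)) = w z" if z: "z \<in> ball 0 1" for z
  proof (cases "z = 0")
    case True
    then show ?thesis
      using w_eq[OF z] by simp
  next
    case False
    have "inj (\<lambda>y. y - z *\<^sub>C A y)"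
    proof (rule injI)
      fix x y
      assume "x - z *\<^sub>C A x = y - z *\<^sub>C A y"
      then have "x - y = z *\<^sub>C A (x - y)"
        by (simp add: A.diff cvs.scale_right_diff_distrib algebra_simps)
      then have "norm (x - y) = cmod z * norm (A (x - y))"
        by (metis norm_scaleC)
      also have "\<dots> \<le> cmod z * norm (x - y)"
        using contraction_adj by (intro mult_left_mono) (simp_all add: contraction_op_def)
      finally have "(1 - cmod z) * norm (x - y) \<le> 0"
        by (simp add: algebra_simps)
      then show "x = y"
        using z by (simp add: mult_le_0_iff)
    qed
    moreover have "inverse z *\<^sub>C w z - z *\<^sub>C A (inverse z *\<^sub>C w z) = D (g z)"
    proof -
      have "inverse z *\<^sub>C w z = A (w z) + D (g z)"
        using w_eq[OF z] False by (metis scaleC_scaleC left_inverse scaleC_one)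
      moreover have "z *\<^sub>C A (inverse z *\<^sub>C w z) = A (w z)"
        using False by (simp add: op_scaleC scaleC_scaleC scaleC_one)
      ultimately show ?thesis
        by simp
    qed
    ultimately have "inv (\<lambda>y. y - z *\<^sub>C A y) (D (g z)) = inverse z *\<^sub>C w z"
      by (rule inv_f_eq)
    then show ?thesis
      using False by (simp add: scaleC_scaleC scaleC_one)
  qed
  have "has_coeffs (\<lambda>z. Ds (w z) - T (g z)) (char_output b)"
    unfolding char_output_def[abs_def] by (rule has_coeffs_diff[OF Dsw Tg])
  then show ?thesis
  proof (rule has_coeffs_cong)
    fix z :: complex
    assume z: "z \<in> ball 0 1"
    show "Ds (w z) - T (g z) = mult_op (char_fun T) g z"
      using z by (simp add: mult_op_def char_fun_def resolvent[symmetric] op_scaleC)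
  qed
qed

text \<open>The colligation identity for the free orbit of \<open>h\<close> against the states
  telescopes. It starts at 0 because \<open>state b 0 = 0\<close> and ends at 0 because the states
  stay bounded while the orbit tends to 0.\<close>

lemma cinner_coeff_output_sums:
  assumes b: "summable (\<lambda>k. (norm (b k))\<^sup>2)"
  shows "(\<lambda>k. cinner (coeff h k) (char_output b k)) sums 0"
proof -
  let ?f = "\<lambda>k. cinner ((A ^^ k) h) (state b k)"
  have "?f \<longlonglongrightarrow> 0"
  proof (rule Lim_null_comparison)
    have "norm (?f k) \<le> norm ((A ^^ k) h) * sqrt (\<Sum>k. (norm (b k))\<^sup>2)" for k
      by (rule order_trans[OF norm_cinner_le mult_left_mono[OF norm_state_le[OF b]]]) simp
    then show "\<forall>\<^sub>F k in sequentially. norm (?f k) \<le> norm ((A ^^ k) h) * sqrt (\<Sum>k. (norm (b k))\<^sup>2)"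
      by simp
    show "(\<lambda>k. norm ((A ^^ k) h) * sqrt (\<Sum>k. (norm (b k))\<^sup>2)) \<longlonglongrightarrow> 0"
      by (intro tendsto_mult_left_zero tendsto_norm_zero pure)
  qed
  from telescope_sums'[OF this] have "(\<lambda>k. ?f k - ?f (Suc k)) sums 0"
    by simp
  moreover have "cinner (coeff h k) (char_output b k) = ?f k - ?f (Suc k)" for k
    using colligation_unitary[of "(A ^^ k) h" 0 "state b k" "b k"]
    by (simp add: coeff_def char_output_def T.zero D.zero eq_diff_eq add.commute)
  ultimately show ?thesis
    by simp
qed

section \<open>The range of the isometry is the model space\<close>

lemma to_model_in_model_space: "to_model h \<in> model_space T"
  unfolding model_space_def orth_compl_def
proof (intro CollectI conjI ballI to_model_in_hardy)
  fix F
  assume "F \<in> mult_op (char_fun T) ` hardy (defect_space T)"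
  then obtain g where F: "F = mult_op (char_fun T) g" and g: "g \<in> hardy (defect_space T)"
    by (elim imageE)
  from g obtain b where b: "summable (\<lambda>k. (norm (b k))\<^sup>2)" "has_coeffs g b"
    unfolding hardy_iff by (elim exE conjE)
  show "hardy_inner (to_model h) F = 0"
    unfolding F
    by (rule hardy_inner_eqI[OF has_coeffs_to_model has_coeffs_char_fun[OF b(2,1)]
          cinner_coeff_output_sums[OF b(1)]])
qed

text \<open>The impulse response: these are the Taylor coefficients of the characteristic function
  at \<open>x\<close>, delayed by \<open>m\<close> steps.\<close>

lemma output_single:
  assumes "b = (\<lambda>k. if k = m then x else 0)"
  shows "k < m \<Longrightarrow> char_output b k = 0" "char_output b m = - T x" "char_output b (k + Suc m) = coeff (D x) k"
proof -
  have 0: "state b k = 0" if "k \<le> m" for k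
    using that by (induction k) (simp_all add: assms A.zero D.zero)
  have 1: "state b (k + Suc m) = (A ^^ k) (D x)" for k
    by (induction k) (simp_all add: assms 0[unfolded assms] A.zero D.zero)
  show "k < m \<Longrightarrow> char_output b k = 0" "char_output b m = - T x"
    using 0 by (simp_all add: char_output_def assms T.zero Ds.zero)
  show "char_output b (k + Suc m) = coeff (D x) k"
    unfolding char_output_def 1 by (simp add: assms coeff_def T.zero)
qed

lemma model_space_coeff_relation:
  assumes f: "f \<in> model_space T" "has_coeffs f a" and a: "summable (\<lambda>k. (norm (a k))\<^sup>2)"
    and x: "x \<in> defect_space T"
  shows "(\<Sum>k. cinner (a (k + Suc m)) (coeff (D x) k)) = cinner (a m) (T x)"
proof -
  define b where "b = (\<lambda>k. if k = m then x else 0)"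
  note out = output_single[OF b_def]
  have b: "summable (\<lambda>k. (norm (b k))\<^sup>2)"
    by (rule summable_finite[of "{m}"]) (simp_all add: b_def)
  define g where "g = power_series b"
  have g: "has_coeffs g b"
    unfolding g_def by (rule has_coeffs_power_series[of _ "norm x"]) (simp add: b_def)
  have "g \<in> hardy (defect_space T)"
    unfolding hardy_iff
  proof (intro exI[of _ b] conjI allI impI b g)
    show "b k \<in> defect_space T" for k
      using x cvs.subspace_0[OF csubspace_defect_space[OF contraction]] by (simp add: b_def)
    show "z \<notin> ball 0 1 \<Longrightarrow> g z = 0" for z
      unfolding g_def by (rule power_series_outside)
  qed
  then have "hardy_inner f (mult_op (char_fun T) g) = 0"
    using f(1) unfolding model_space_def orth_compl_def by simp
  moreover have s: "summable (\<lambda>k. cinner (a k) (char_output b k))"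
  proof -
    have "summable (\<lambda>k. cinner (a (k + Suc m)) (coeff (D x) k))"
      by (intro summable_cinner(1) summable_norm_coeff summable_ignore_initial_segment a)
    then have "summable (\<lambda>k. cinner (a (k + Suc m)) (char_output b (k + Suc m)))"
      by (simp only: out(3))
    then show ?thesis
      by (subst (asm) summable_iff_shift)
  qed
  ultimately have "(\<Sum>k. cinner (a k) (char_output b k)) = 0"
    using hardy_inner_eqI[OF f(2) has_coeffs_char_fun[OF g b] summable_sums[OF s]] by simp
  moreover have "(\<Sum>k<Suc m. cinner (a k) (char_output b k)) = - cinner (a m) (T x)"
    using out(1,2) by simp
  ultimately show ?thesis
    using suminf_split_initial_segment[OF s, of "Suc m"] by (simp only: out(3)) simp
qed

text \<open>The candidate \<open>h m\<close> is the adjoint of \<open>to_model\<close> applied to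
  the \<open>m\<close>-fold backward shift of \<open>f\<close>. The adjoint colligation sends
  \<open>(h (Suc m), a m)\<close> to \<open>(h m, 0)\<close>: the first component is
  \<open>h_eq\<close>, and the zero encodes orthogonality to the range of the characteristic
  function. Inverting the unitary colligation gives \<open>A (h m) = h (Suc m)\<close> and
  \<open>Ds (h m) = a m\<close>, so \<open>f\<close> comes from \<open>h 0\<close>.\<close>

lemma model_space_subset: "f \<in> model_space T \<Longrightarrow> \<exists>h. f = to_model h"
proof -
  assume f: "f \<in> model_space T"
  then have "f \<in> hardy (defect_space (adj T))"
    unfolding model_space_def orth_compl_def by simp
  then obtain a where aE: "\<And>k. a k \<in> defect_space (adj T)"
    and a: "summable (\<lambda>k. (norm (a k))\<^sup>2)" "has_coeffs f a"
    and f0: "\<And>z. z \<notin> ball 0 1 \<Longrightarrow> f z = 0"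
    unfolding hardy_iff by metis
  let ?\<phi> = "\<lambda>m y. \<Sum>k. cinner (coeff y k) (a (k + m))"
  have sum: "summable (\<lambda>k. (norm (a (k + m)))\<^sup>2)" for m
    by (rule summable_ignore_initial_segment[OF a(1)])
  note sc = summable_cinner[OF summable_norm_coeff sum]
  have "\<exists>h. \<forall>y. ?\<phi> m y = cinner y h" for m
  proof -
    have "\<exists>h\<in>UNIV. \<forall>y\<in>UNIV. ?\<phi> m y = cinner y h"
    proof (rule riesz)
      fix x y :: 'a and c :: complex
      show "?\<phi> m (x + y) = ?\<phi> m x + ?\<phi> m y"
        by (simp add: coeff_add cinner_add_left suminf_add[OF sc(1) sc(1)])
      show "?\<phi> m (c *\<^sub>C x) = c * ?\<phi> m x"
        by (simp add: coeff_scaleC cinner_scaleC_left suminf_mult[OF sc(1)])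
      show "cmod (?\<phi> m x) \<le> sqrt (\<Sum>k. (norm (a (k + m)))\<^sup>2) * norm x"
        using sc(2)[of x m] by (simp add: sums_unique[OF norm_coeff_sums, symmetric] mult.commute)
    qed simp_all
    then show ?thesis
      by simp
  qed
  then obtain h where h: "\<And>m y. ?\<phi> m y = cinner y (h m)"
    by metis
  have h_eq: "h m = Ds (a m) + T (h (Suc m))" for m
  proof (rule cinner_eqI)
    fix y
    have "cinner y (h m) = cinner (coeff y 0) (a m) + (\<Sum>k. cinner (coeff y (Suc k)) (a (Suc k + m)))"
      using suminf_split_head[OF sc(1)[of y m]] by (simp add: h[symmetric])
    also have "\<dots> = cinner (Ds y) (a m) + ?\<phi> (Suc m) (A y)"
      by (simp add: coeff_Suc) (simp add: coeff_def)
    also have "\<dots> = cinner y (Ds (a m) + T (h (Suc m)))"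
      by (simp only: h cinner_add_right cinner_Ds cinner_A)
    finally show "cinner y (h m) = cinner y (Ds (a m) + T (h (Suc m)))" .
  qed
  have D_h: "D (h (Suc m)) = A (a m)" for m
  proof -
    \<comment> \<open>Orthogonality is available only for inputs in \<open>defect_space T\<close>;
      since both sides of \<open>D_h\<close> lie there, their difference is an admissible test
      vector.\<close>
    have rel: "cinner x (D (h (Suc m))) = cinner x (A (a m))" if x: "x \<in> defect_space T" for x
    proof -
      have "cinner x (D (h (Suc m))) = ?\<phi> (Suc m) (D x)"
        by (simp only: h cinner_D)
      also have "\<dots> = (\<Sum>k. cnj (cinner (a (k + Suc m)) (coeff (D x) k)))"
        by (simp only: cinner_commute[symmetric])
      also have "\<dots> = cnj (\<Sum>k. cinner (a (k + Suc m)) (coeff (D x) k))"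
        by (rule bounded_linear.suminf[OF bounded_linear_cnj
              summable_cinner(1)[OF sum summable_norm_coeff], symmetric])
      also have "\<dots> = cnj (cinner (a m) (T x))"
        by (simp only: model_space_coeff_relation[OF f a(2,1) x])
      also have "\<dots> = cinner x (A (a m))"
        by (simp only: cinner_commute[symmetric] cinner_T)
      finally show ?thesis .
    qed
    define d where "d = D (h (Suc m)) - A (a m)"
    have "d \<in> defect_space T"
      unfolding d_def
      by (intro cvs.subspace_diff[OF csubspace_defect_space[OF contraction]]
          defect_in_defect_space[OF contraction] A_defect_space aE)
    then have "cinner d d = 0"
      using rel[of d] by (subst (2) d_def) (simp only: cinner_diff_right diff_self)
    then show ?thesis
      by (simp add: d_def)
  qed
  have A_h: "A (h m) = h (Suc m)" for m
    unfolding h_eq[of m] A.add A_Ds D_h[symmetric] D_D by simp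
  have hA: "h m = (A ^^ m) (h 0)" for m
    by (induction m) (simp_all flip: A_h)
  have "Ds (h m) = a m" for m
    unfolding h_eq[of m] Ds.add Ds_Ds T_D[symmetric] D_h by simp
  then have "coeff (h 0) = a"
    unfolding coeff_def hA[symmetric] by (rule ext)
  then have "has_coeffs f (coeff (h 0))"
    using a(2) by simp
  then have "f = to_model (h 0)"
    by (rule has_coeffs_ext[OF _ has_coeffs_to_model f0 to_model_outside])
  then show ?thesis
    by (rule exI)
qed

lemma model_space_eq: "model_space T = range to_model"
proof (intro equalityI subsetI)
  show "f \<in> range to_model" if "f \<in> model_space T" for f
    using model_space_subset[OF that] by (elim exE) (simp only: rangeI)
  show "f \<in> model_space T" if "f \<in> range to_model" for f
    using that by (elim rangeE) (simp only: to_model_in_model_space)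
qed

lemma unitary_onto_to_model: "unitary_onto (model_space T) to_model"
  unfolding unitary_onto_def model_space_eq
  by (intro conjI allI to_model_add to_model_scaleC hardy_inner_to_model
      inj_on_imp_bij_betw inj_to_model)

text \<open>As the model space is the range of an isometry, a compression is identified by its
  pairings with all \<open>to_model g\<close>; no general projection theorem in the Hardy space is
  invoked.\<close>

lemma hardy_proj_eq:
  assumes F: "has_coeffs F a" and s: "\<And>g. (\<lambda>k. cinner (a k) (coeff g k)) sums cinner h g"
  shows "hardy_proj (model_space T) F = to_model h"
proof -
  have inner: "hardy_inner (\<lambda>z. F z - to_model x z) (to_model g) = cinner h g - cinner x g" for x g
  proof (rule hardy_inner_eqI[OF has_coeffs_diff[OF F has_coeffs_to_model] has_coeffs_to_model])
    show "(\<lambda>k. cinner (a k - coeff x k) (coeff g k)) sums (cinner h g - cinner x g)"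
      unfolding cinner_diff_left by (intro sums_diff s cinner_coeff_sums)
  qed
  show ?thesis
    unfolding hardy_proj_def model_space_eq
  proof (rule the_equality)
    show "to_model h \<in> range to_model \<and>
        (\<forall>g\<in>range to_model. hardy_inner (\<lambda>z. F z - to_model h z) g = 0)"
      by (simp add: inner)
    fix p
    assume p: "p \<in> range to_model \<and> (\<forall>g\<in>range to_model. hardy_inner (\<lambda>z. F z - p z) g = 0)"
    then obtain x where x: "p = to_model x"
      by (elim conjE rangeE)
    have "cinner h g = cinner x g" for g
      using p inner[of x g] by (simp add: x)
    then have "cinner g h = cinner g x" for g
      by (metis cinner_commute)
    then show "p = to_model h"
      unfolding x by (metis cinner_eqI)
  qed
qed

text \<open>Multiplication by \<open>z\<close> pairs coefficient \<open>j\<close> of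
  \<open>h\<close> with coefficient \<open>Suc j\<close> of \<open>g\<close>, which is coefficient
  \<open>j\<close> of \<open>A g\<close>; the sum is \<open>cinner h (A g)\<close>.\<close>

lemma model_shift: "hardy_proj (model_space T) (mult_op (\<lambda>z x. z *\<^sub>C x) (to_model h)) = to_model (T h)"
proof (rule hardy_proj_eq)
  show "has_coeffs (mult_op (\<lambda>z x. z *\<^sub>C x) (to_model h))
      (\<lambda>k. case k of 0 \<Rightarrow> 0 | Suc j \<Rightarrow> coeff h j)"
    by (rule has_coeffs_cong[OF has_coeffs_shift[OF has_coeffs_to_model]]) (simp add: mult_op_def)
  fix g
  have "(\<lambda>k. cinner (coeff h k) (coeff (A g) k)) sums cinner h (A g)"
    by (rule cinner_coeff_sums)
  then have "(\<lambda>k. cinner (case Suc k of 0 \<Rightarrow> 0 | Suc j \<Rightarrow> coeff h j) (coeff g (Suc k)))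
      sums cinner (T h) g"
    by (simp add: coeff_Suc cinner_T)
  then show "(\<lambda>k. cinner (case k of 0 \<Rightarrow> 0 | Suc j \<Rightarrow> coeff h j) (coeff g k)) sums cinner (T h) g"
    by (subst (asm) sums_Suc_iff) simp
qed

text \<open>Here \<open>R\<close> and \<open>Q\<close> stand for \<open>S i\<close> and
  \<open>S (n - i)\<close>. The equation for \<open>Q\<close> is used through its adjoint, which is
  how the adjoint of \<open>Z\<close> appears in the coefficient of \<open>z\<close>.\<close>

lemma model_pencil:
  assumes R: "bounded_op R" and Q: "bounded_op Q"
    and Y: "bounded_op_on (defect_space (adj T)) Y" and Z: "bounded_op_on (defect_space (adj T)) Z"
    and RY: "\<And>x. R x - T (adj Q x) = Ds (Y (Ds x))"
    and QZ: "\<And>x. Q x - T (adj R x) = Ds (Z (Ds x))"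
  shows "hardy_proj (model_space T)
      (mult_op (\<lambda>z x. Y x + z *\<^sub>C adj_on (defect_space (adj T)) Z x) (to_model h)) = to_model (R h)"
proof -
  let ?E = "defect_space (adj T)"
  let ?Z = "adj_on ?E Z"
  note E = csubspace_defect_space[OF contraction_adj] closed_defect_space[OF contraction_adj]
  have Z': "bounded_op_on ?E ?Z"
    by (rule bounded_op_on_adj_on[OF E Z])
  note in_E = defect_in_defect_space[OF contraction_adj]
  have 1: "cinner (Y (Ds p)) (Ds q) = cinner (R p) q - cinner (adj Q p) (A q)" for p q
    by (simp only: cinner_Ds[symmetric] RY[symmetric] cinner_diff_left cinner_T)
  have 2: "cinner (?Z (Ds p)) (Ds q) = cinner (adj Q p) q - cinner (R (A p)) q" for p q
  proof -
    have "cinner (Ds q) (?Z (Ds p)) = cinner (Z (Ds q)) (Ds p)"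
      by (rule cinner_adj_on[OF E Z in_E in_E, symmetric])
    also have "\<dots> = cinner (Q q) p - cinner (adj R q) (A p)"
      by (simp only: cinner_Ds[symmetric] QZ[symmetric] cinner_diff_left cinner_T)
    also have "\<dots> = cinner q (adj Q p) - cinner q (R (A p))"
      by (simp only: cinner_adj_right[OF Q] cinner_adj_left[OF R])
    finally have "cnj (cinner (Ds q) (?Z (Ds p))) = cnj (cinner q (adj Q p) - cinner q (R (A p)))"
      by (rule arg_cong)
    then show ?thesis
      by (simp only: complex_cnj_diff cinner_commute[symmetric])
  qed
  define a where "a k = Y (coeff h k) + (case k of 0 \<Rightarrow> 0 | Suc j \<Rightarrow> ?Z (coeff h j))" for k
  show ?thesis
  proof (rule hardy_proj_eq)
    have Yh: "has_coeffs (\<lambda>z. Y (to_model h z)) (\<lambda>k. Y (coeff h k))"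
      by (rule has_coeffs_apply[OF E Y coeff_in has_coeffs_to_model]) simp
    have Zh: "has_coeffs (\<lambda>z. ?Z (to_model h z)) (\<lambda>k. ?Z (coeff h k))"
      by (rule has_coeffs_apply[OF E Z' coeff_in has_coeffs_to_model]) simp
    show "has_coeffs (mult_op (\<lambda>z x. Y x + z *\<^sub>C ?Z x) (to_model h)) a"
      unfolding a_def[abs_def]
      by (rule has_coeffs_cong[OF has_coeffs_add[OF Yh has_coeffs_shift[OF Zh]]])
        (simp add: mult_op_def)
    fix g
    \<comment> \<open>This is the boundary term of the telescope: in coefficient
      \<open>Suc k\<close> the constant part of the symbol leaves \<open>- b (Suc k)\<close>, the
      \<open>z\<close> part leaves \<open>b k\<close>, and their \<open>R\<close> terms cancel.
      Coefficient 0 has no \<open>z\<close> part and contributes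
      \<open>cinner (R h) g - b 0\<close>.\<close>
    define b where "b k = cinner (adj Q ((A ^^ k) h)) ((A ^^ Suc k) g)" for k
    have "(\<lambda>k. adj Q ((A ^^ k) h)) \<longlonglongrightarrow> adj Q 0"
      by (rule bounded_linear.tendsto[OF bounded_op_bounded_linear[OF bounded_op_adj[OF Q]] pure])
    then have "b \<longlonglongrightarrow> cinner (adj Q 0) (0::'a)"
      unfolding b_def[abs_def] by (rule tendsto_cinner[OF _ LIMSEQ_Suc[OF pure]])
    then have "b \<longlonglongrightarrow> 0"
      by simp
    then have "(\<lambda>k. b k - b (Suc k)) sums b 0"
      using telescope_sums'[of b 0] by simp
    moreover have "cinner (a (Suc k)) (coeff g (Suc k)) = b k - b (Suc k)" for k
      by (simp add: a_def b_def coeff_def cinner_add_left 1 2)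
    ultimately have "(\<lambda>k. cinner (a (Suc k)) (coeff g (Suc k))) sums b 0"
      by simp
    then have "(\<lambda>k. cinner (a k) (coeff g k)) sums (b 0 + cinner (a 0) (coeff g 0))"
      by (rule sums_Suc)
    moreover have "cinner (a 0) (coeff g 0) = cinner (R h) g - b 0"
      by (simp add: a_def b_def coeff_def 1)
    ultimately show "(\<lambda>k. cinner (a k) (coeff g k)) sums cinner (R h) g"
      by simp
  qed
qed

end

theorem lemma5p1:
  fixes n :: nat and S :: "nat \<Rightarrow> 'a::chilbert_space \<Rightarrow> 'a"
  assumes "n \<ge> 2"
    and "agler_young n S"
    and "pure_tuple n S"
    and "\<not> isometry_op (S n)"
    and "finite_cdim (defect_space (adj (S n)))"
  shows "\<exists>Y :: nat \<Rightarrow> 'a \<Rightarrow> 'a.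
    (\<forall>i\<in>{1..<n}. bounded_op_on (defect_space (adj (S n))) (Y i)) \<and>
    commuting_on n (model_space (S n)) (model_tuple n (S n) Y) \<and>
    unitarily_equivalent n S (model_space (S n)) (model_tuple n (S n) Y)"
proof -
  interpret pure_contraction "S n"
  proof
    show "contraction_op (S n)"
      by (rule agler_young_contraction[OF assms(2)])
    show "(\<lambda>m. (adj (S n) ^^ m) x) \<longlonglongrightarrow> 0" for x
      using assms(3) by (simp add: pure_tuple_def)
  qed
  let ?E = "defect_space (adj (S n))"
  have "\<forall>i\<in>{1..<n}. \<exists>Y. bounded_op Y \<and> range Y \<subseteq> ?E \<and>
      (\<forall>x. S i x - S n (adj (S (n - i)) x) = Ds (Y (Ds x)))"
    by (intro ballI agler_young_adjoint_factorization[OF assms(2) _ assms(5)])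
  from bchoice[OF this] obtain Y where Y: "\<forall>i\<in>{1..<n}. bounded_op (Y i) \<and> range (Y i) \<subseteq> ?E \<and>
      (\<forall>x. S i x - S n (adj (S (n - i)) x) = Ds (Y i (Ds x)))"
    by (elim exE)
  \<comment> \<open>Each \<open>Y i\<close> is bounded on the whole space with range in
    \<open>?E\<close>, so it restricts to an operator on \<open>?E\<close>.\<close>
  have YE: "bounded_op_on ?E (Y i)" if "i \<in> {1..<n}" for i
    using bspec[OF Y that] unfolding bounded_op_on_def
    by (simp add: image_subset_iff) (elim conjE ex_forward, simp)
  have eq: "S i x - S n (adj (S (n - i)) x) = Ds (Y i (Ds x))" if "i \<in> {1..<n}" for i x
    using bspec[OF Y that] by simp
  let ?R = "model_tuple n (S n) Y"
  have model: "to_model (S i x) = ?R i (to_model x)" if i: "i \<in> {1..n}" for i x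
  proof (cases "i = n")
    case True
    then show ?thesis
      by (simp add: model_tuple_def model_shift)
  next
    case False
    then have i': "i \<in> {1..<n}" and j: "n - i \<in> {1..<n}" "n - (n - i) = i"
      using i by auto
    have j': "n - i \<in> {1..n}"
      using j(1) by simp
    have "?R i (to_model x) = to_model (S i x)"
      unfolding model_tuple_def
      using i' model_pencil[OF agler_young_bounded[OF assms(2) i] agler_young_bounded[OF assms(2) j']
          YE[OF i'] YE[OF j(1)] eq[OF i'] eq[OF j(1), unfolded j(2)], of x]
      by simp
    then show ?thesis
      by (rule sym)
  qed
  \<comment> \<open>By \<open>model\<close>, products of model operators on
    \<open>to_model x\<close> are images of products of the \<open>S i\<close>, so commutation is
    transported.\<close>
  have "commuting_on n (model_space (S n)) ?R"
    unfolding commuting_on_def model_space_eq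
  proof (intro conjI ballI)
    fix i f
    assume i: "i \<in> {1..n}" and "f \<in> range to_model"
    then obtain x where f: "f = to_model x"
      by (elim rangeE)
    show "?R i f \<in> range to_model"
      unfolding f model[OF i, symmetric] by (rule rangeI)
    fix j
    assume j: "j \<in> {1..n}"
    show "?R i (?R j f) = ?R j (?R i f)"
      unfolding f model[OF i, symmetric] model[OF j, symmetric]
      by (simp only: agler_young_commute[OF assms(2) i j])
  qed
  moreover have "unitarily_equivalent n S (model_space (S n)) ?R"
    unfolding unitarily_equivalent_def
    by (intro exI[of _ to_model] conjI ballI allI unitary_onto_to_model model)
  ultimately show ?thesis
    using YE by (intro exI[of _ Y] conjI ballI)
qed

end
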